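(* Let $P$ be a $\mathrm{TN}$-poset. For each integer $n$ with $0\le n\le\rho(P)$, all zeros of the $n$th chain polynomial $p_n(t)$ of $P$ are real and located in the interval $[-1,0]$. Moreover $p_n(t)\prec p_{n+1}(t)$ whenever $n+1\le\rho(P)$.
   Context: Let $P$ be a locally finite poset such that $\rho(x)=\max\{k: x_0<x_1<\cdots<x_k=x,\ x_i\in P\}$ is finite for every $x\in P$; $\rho$ is the quasi-rank function of $P$, and $\rho(P)=\sup_{x\in P}\rho(x)\in\mathbb{N}\cup\{\infty\}$ is the quasi-rank of $P$. Write $\langle x\rangle=\{z\in P:z\le x\}$. $P$ is quasi-rank uniform if for all $x,y\in P$ with $\rho(x)=\rho(y)$ one has $|\{z\in\langle x\rangle:\rho(z)=k\}|=|\{z\in\langle y\rangle:\rho(z)=k\}|$ (finite) for all $0\le k\le\rho(x)$. Then put $r_{n,k}=|\{z\in\langle x\rangle:\rho(z)=k\}|$ for any $x$ with $\rho(x)=n$, and $R(P)=(r_{n,k})_{n,k=0}^{N}$, $N=\rho(P)$ (a lower triangular matrix with unit diagonal). A quasi-rank uniform poset $P$ is a $\mathrm{TN}$-poset if $R(P)$ is totally nonnegative, i.e. all its minors are nonnegative. The $n$th chain polynomial of $P$ is $p_0(t)=1$ for $n=0$ and, for $n\ge1$, $$p_n(t)=\sum_{j\ge1}|\{x_0<x_1<\cdots<x_j=x:\rho(x_0)=0\}|\,t^j,$$ where $x$ is any fixed element with $\rho(x)=n$ (the result does not depend on $x$); equivalently $p_n(t)=t\sum_{k=0}^{n-1}r_{n,k}p_k(t)$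 for $n\ge1$. Interlacing: for real-rooted $f,g$ with positive leading coefficients and zeros $\cdots\le\alpha_2\le\alpha_1$ and $\cdots\le\beta_2\le\beta_1$, $f\prec g$ means $\cdots\le\alpha_2\le\beta_2\le\alpha_1\le\beta_1$; in particular $\deg g\in\{\deg f,\deg f+1\}$. *)

theory Defs
  imports
    "HOL-Analysis.Analysis"
    "HOL-Computational_Algebra.Polynomial"
    "HOL-Library.Extended_Nat"
    "HOL-Library.Multiset"
    "Jordan_Normal_Form.Determinant"
begin

text \<open>
  A poset is a subset \<open>P\<close> of a type of class \<^class>\<open>order\<close>, with the induced order.
  A chain \<open>x\<^sub>0 < \<dots> < x\<^sub>k\<close> is represented by the list \<open>[x\<^sub>0, \<dots>, x\<^sub>k]\<close>, of length \<open>k + 1\<close>.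
\<close>

definition chains_to :: "'a::order set \<Rightarrow> 'a \<Rightarrow> nat \<Rightarrow> 'a list set" where
  "chains_to P x k =
     {xs. length xs = Suc k \<and> set xs \<subseteq> P \<and> sorted_wrt (<) xs \<and> last xs = x}"

definition locally_finite_poset :: "'a::order set \<Rightarrow> bool" where
  "locally_finite_poset P \<longleftrightarrow> (\<forall>x\<in>P. \<forall>y\<in>P. finite {z\<in>P. x \<le> z \<and> z \<le> y})"

definition finite_quasi_rank :: "'a::order set \<Rightarrow> bool" where
  "finite_quasi_rank P \<longleftrightarrow> (\<forall>x\<in>P. finite {k. chains_to P x k \<noteq> {}})"

text \<open>Only meaningful under \<^const>\<open>finite_quasi_rank\<close>, since \<^const>\<open>Max\<close> is unspecified on
  infinite sets.\<close>

definition quasi_rank :: "'a::order set \<Rightarrow> 'a \<Rightarrow> nat" where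
  "quasi_rank P x = Max {k. chains_to P x k \<noteq> {}}"

definition poset_quasi_rank :: "'a::order set \<Rightarrow> enat" where
  "poset_quasi_rank P = (SUP x\<in>P. enat (quasi_rank P x))"

definition down_level :: "'a::order set \<Rightarrow> 'a \<Rightarrow> nat \<Rightarrow> 'a set" where
  "down_level P x k = {z\<in>P. z \<le> x \<and> quasi_rank P z = k}"

definition quasi_rank_uniform :: "'a::order set \<Rightarrow> bool" where
  "quasi_rank_uniform P \<longleftrightarrow>
     locally_finite_poset P \<and> finite_quasi_rank P \<and>
     (\<forall>x\<in>P. \<forall>y\<in>P. quasi_rank P x = quasi_rank P y \<longrightarrow>
        (\<forall>k\<le>quasi_rank P x.
           finite (down_level P x k) \<and> finite (down_level P y k) \<and>
           card (down_level P x k) = card (down_level P y k)))"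

text \<open>For \<open>n \<le> \<rho>(P)\<close> elements of quasi-rank \<open>n\<close> exist in a nonempty \<open>P\<close> (take an initial part
  of a maximal chain), and neither the numbers \<open>r\<^bsub>n,k\<^esub>\<close> nor the chain polynomials
  below depend on which one is chosen.\<close>

definition rank_elem :: "'a::order set \<Rightarrow> nat \<Rightarrow> 'a" where
  "rank_elem P n = (SOME x. x \<in> P \<and> quasi_rank P x = n)"

definition rank_matrix :: "'a::order set \<Rightarrow> nat \<Rightarrow> nat \<Rightarrow> nat" where
  "rank_matrix P n k = card (down_level P (rank_elem P n) k)"

text \<open>Total nonnegativity of a matrix \<open>(A n k)\<close> with \<open>0 \<le> n, k \<le> N\<close>, where possibly \<open>N = \<infinity>\<close>:
  the minors are indexed by rows \<open>i 0 < \<dots> < i (m - 1)\<close> and columns \<open>j 0 < \<dots> < j (m - 1)\<close>.\<close>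

definition totally_nonnegative :: "enat \<Rightarrow> (nat \<Rightarrow> nat \<Rightarrow> real) \<Rightarrow> bool" where
  "totally_nonnegative N A \<longleftrightarrow>
     (\<forall>m i j. strict_mono_on {..<m} i \<and> strict_mono_on {..<m} j \<and>
        (\<forall>a<m. enat (i a) \<le> N \<and> enat (j a) \<le> N) \<longrightarrow>
        Determinant.det (Matrix.mat m m (\<lambda>(a, b). A (i a) (j b))) \<ge> 0)"

definition TN_poset :: "'a::order set \<Rightarrow> bool" where
  "TN_poset P \<longleftrightarrow>
     quasi_rank_uniform P \<and>
     totally_nonnegative (poset_quasi_rank P) (\<lambda>n k. real (rank_matrix P n k))"

text \<open>Chains ending in an element of quasi-rank \<open>n\<close> have \<open>j \<le> n\<close>, so the sum over all
  \<open>j \<ge> 1\<close> may be cut off at \<open>n\<close>.\<close>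

definition chain_poly :: "'a::order set \<Rightarrow> nat \<Rightarrow> real poly" where
  "chain_poly P n =
     (if n = 0 then 1
      else \<Sum>j=1..n. monom (real (card {xs \<in> chains_to P (rank_elem P n) j.
                                           quasi_rank P (hd xs) = 0})) j)"

definition real_rooted :: "real poly \<Rightarrow> bool" where
  "real_rooted f \<longleftrightarrow> (\<forall>z::complex. poly (map_poly complex_of_real f) z = 0 \<longrightarrow> z \<in> \<real>)"

definition zeros_desc :: "real poly \<Rightarrow> real list" where
  "zeros_desc f = rev (sorted_list_of_multiset (proots f))"

text \<open>With 0-based indices, \<open>\<dots> \<le> \<alpha>\<^sub>2 \<le> \<beta>\<^sub>2 \<le> \<alpha>\<^sub>1 \<le> \<beta>\<^sub>1\<close> says
  \<open>\<alpha>\<^sub>i \<le> \<beta>\<^sub>i\<close> and \<open>\<beta>\<^bsub>i+1\<^esub> \<le> \<alpha>\<^sub>i\<close>. Nonzero constants are real-rooted with no zeros.\<close>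

definition interlaces :: "real poly \<Rightarrow> real poly \<Rightarrow> bool" where
  "interlaces f g \<longleftrightarrow>
     real_rooted f \<and> real_rooted g \<and> lead_coeff f > 0 \<and> lead_coeff g > 0 \<and>
     (let \<alpha> = zeros_desc f; \<beta> = zeros_desc g in
        (length \<beta> = length \<alpha> \<or> length \<beta> = length \<alpha> + 1) \<and>
        (\<forall>i<length \<alpha>. \<alpha> ! i \<le> \<beta> ! i) \<and>
        (\<forall>i. i + 1 < length \<beta> \<longrightarrow> \<beta> ! (i + 1) \<le> \<alpha> ! i))"

end

theory Submission
  imports Defs "HOL-Computational_Algebra.Fundamental_Theorem_Algebra"
begin

text \<open>
  Neville elimination on the totally nonnegative matrix \<open>R\<close> writes the recurrence
  \<open>p\<^bsub>n+1\<^esub> = t \<Sum>\<^bsub>k\<le>n\<^esub> r\<^bsub>n+1,k\<^esub> p\<^sub>k\<close> through polynomials \<open>q\<^bsub>n,0\<^esub>, \<dots>, q\<^bsub>n,n\<^esub> = p\<^sub>n\<close> and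
  weights \<open>\<lambda>\<^bsub>n,j\<^esub> \<ge> 0\<close> such that
  \<open>q\<^bsub>n+1,k\<^esub> = t \<Sum>\<^bsub>j<k\<^esub> \<lambda>\<^bsub>n,j\<^esub> q\<^bsub>n,j\<^esub> + (1 + t) \<Sum>\<^bsub>j\<ge>k\<^esub> \<lambda>\<^bsub>n,j\<^esub> q\<^bsub>n,j\<^esub>\<close>.
  At any fixed \<open>t\<close> in the upper half plane the values \<open>q\<^bsub>n,0\<^esub>(t), \<dots>, q\<^bsub>n,n\<^esub>(t)\<close> have increasing
  arguments within a sector narrow enough for this step to preserve the property, so they do not
  vanish. For real \<open>t\<close> outside \<open>[-1, 0]\<close> the multipliers \<open>t\<close> and \<open>1 + t\<close> have the same sign, and
  again no value vanishes. Finally \<open>Im (p\<^bsub>n+1\<^esub> / p\<^sub>n) \<ge> 0\<close> on the upper half plane, and the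
  boundary values of the argument on the real axis turn this into interlacing of the zeros.
\<close>

section \<open>Neville elimination\<close>

text \<open>Consecutive rows suffice and are what elimination preserves: subtracting multiples of
  the row above relates a new minor of this kind to a single old one with one more row and column.
  The bound \<open>k\<close> discards rows and columns that the elimination has finished
  with.\<close>

definition contiguous_minors_nonneg :: "nat \<Rightarrow> nat \<Rightarrow> (nat \<Rightarrow> nat \<Rightarrow> real) \<Rightarrow> bool" where
  "contiguous_minors_nonneg N k B \<longleftrightarrow>
     (\<forall>m i c. k \<le> i \<and> i + m \<le> Suc N \<and> strict_mono_on {..<m} c \<and> (\<forall>a<m. k \<le> c a \<and> c a \<le> N) \<longrightarrow>
        Determinant.det (Matrix.mat m m (\<lambda>(a, b). B (i + a) (c b))) \<ge> 0)"

lemma contiguous_minors_nonnegD: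
  assumes "contiguous_minors_nonneg N k B" "k \<le> i" "i + m \<le> Suc N"
    "strict_mono_on {..<m} c" "\<And>a. a < m \<Longrightarrow> k \<le> c a \<and> c a \<le> N"
  shows "Determinant.det (Matrix.mat m m (\<lambda>(a, b). B (i + a) (c b))) \<ge> 0"
  using assms unfolding contiguous_minors_nonneg_def by blast

lemma contiguous_minors_nonneg_entry:
  assumes "contiguous_minors_nonneg N k B" "k \<le> i" "i \<le> N" "k \<le> j" "j \<le> N"
  shows "B i j \<ge> 0"
proof -
  have "Determinant.det (Matrix.mat 1 1 (\<lambda>(a, b). B (i + a) ((\<lambda>_. j) b))) \<ge> 0"
    using assms by (intro contiguous_minors_nonnegD[OF assms(1)]) (auto simp: strict_mono_on_def)
  then show ?thesis
    by (subst (asm) det_single) auto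
qed

lemma det_mat_2x2:
  "Determinant.det (Matrix.mat 2 2 (\<lambda>(a, b). f a b)) = f 0 0 * f 1 1 - f 0 1 * (f 1 0 :: real)"
proof -
  let ?M = "Matrix.mat 2 2 (\<lambda>(a, b). f a b)"
  have "Determinant.det ?M = (\<Sum>i<2. ?M $$ (i, 0) * cofactor ?M i 0)"
    by (rule laplace_expansion_column) auto
  also have "\<dots> = f 0 0 * cofactor ?M 0 0 + f 1 0 * cofactor ?M 1 0"
    by (simp add: numeral_2_eq_2)
  also have "cofactor ?M 0 0 = f 1 1"
    unfolding cofactor_def by (subst det_single) (auto simp: mat_delete_def)
  also have "cofactor ?M 1 0 = - f 0 1"
    unfolding cofactor_def by (subst det_single) (auto simp: mat_delete_def)
  finally show ?thesis by simp
qed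

lemma contiguous_minors_nonneg_2x2:
  assumes "contiguous_minors_nonneg N k B" "k \<le> i" "Suc i \<le> N" "k \<le> j" "j < l" "l \<le> N"
  shows "B i j * B (Suc i) l - B i l * B (Suc i) j \<ge> 0"
proof -
  let ?c = "\<lambda>b::nat. if b = 0 then j else l"
  have "Determinant.det (Matrix.mat 2 2 (\<lambda>(a, b). B (i + a) (?c b))) \<ge> 0"
    using assms by (intro contiguous_minors_nonnegD[OF assms(1)]) (auto simp: strict_mono_on_def)
  then show ?thesis
    by (subst (asm) det_mat_2x2) auto
qed

text \<open>With unit diagonal, a zero at \<open>(n - 1, k)\<close> turns the minor in rows
  \<open>n - 1, n\<close> and columns \<open>k, n - 1\<close> into \<open>- B n k\<close>. Hence
  below a zero pivot there is nothing to clear, and no row exchange is needed.\<close>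

lemma neville_zero_propagates:
  assumes "contiguous_minors_nonneg N k B" "\<And>n. n \<le> N \<Longrightarrow> B n n = 1"
    and "k < n" "n \<le> N" "B (n - 1) k = 0"
  shows "B n k = 0"
proof -
  have "k \<noteq> n - 1" using assms by force
  then have "B (n - 1) k * B (Suc (n - 1)) (n - 1) - B (n - 1) (n - 1) * B (Suc (n - 1)) k \<ge> 0"
    using assms by (intro contiguous_minors_nonneg_2x2[OF assms(1)]) auto
  then have "B n k \<le> 0" using assms by auto
  moreover have "B n k \<ge> 0"
    using assms by (intro contiguous_minors_nonneg_entry[OF assms(1)]) auto
  ultimately show ?thesis by simp
qed

text \<open>If \<open>B (n - 1) k = 0\<close>, the junk value \<open>x / 0 = 0\<close> makes the multiplier vanish, as it
  should since then \<open>B n k = 0\<close> too.\<close>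

definition neville_mult :: "nat \<Rightarrow> (nat \<Rightarrow> nat \<Rightarrow> real) \<Rightarrow> nat \<Rightarrow> real" where
  "neville_mult k B n = B n k / B (n - 1) k"

definition neville_step :: "nat \<Rightarrow> (nat \<Rightarrow> nat \<Rightarrow> real) \<Rightarrow> nat \<Rightarrow> nat \<Rightarrow> real" where
  "neville_step k B n j = (if k < n then B n j - neville_mult k B n * B (n - 1) j else B n j)"

text \<open>Elimination on the rows \<open>i, ..., i + m\<close>, with row \<open>i\<close> kept, is
  left multiplication by the unit lower bidiagonal matrix \<open>L\<close>. The product
  \<open>C\<close> has first column \<open>B i k, 0, ..., 0\<close>, so its determinant is the pivot
  times that of the remaining block.\<close>

lemma neville_minor:
  fixes B :: "nat \<Rightarrow> nat \<Rightarrow> real"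
  assumes "k \<le> i" and cleared: "\<And>a. a < m \<Longrightarrow> neville_step k B (Suc (i + a)) k = 0"
  shows "Determinant.det (Matrix.mat (Suc m) (Suc m) (\<lambda>(a, b). B (i + a) (case_nat k c b))) =
    B i k * Determinant.det (Matrix.mat m m (\<lambda>(a, b). neville_step k B (Suc i + a) (c b)))"
proof -
  let ?M = "Matrix.mat (Suc m) (Suc m) (\<lambda>(a, b). B (i + a) (case_nat k c b))"
  let ?D = "Matrix.mat m m (\<lambda>(a, b). neville_step k B (Suc i + a) (c b))"
  define L where "L = Matrix.mat (Suc m) (Suc m)
    (\<lambda>(a, b). if a = b then 1 else if a = Suc b then - neville_mult k B (i + a) else 0)"
  define C where "C = four_block_mat (Matrix.mat 1 1 (\<lambda>_. B i k)) (Matrix.mat 1 m (\<lambda>(a, b). B i (c b)))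
    (0\<^sub>m m 1) ?D"
  have L: "L \<in> carrier_mat (Suc m) (Suc m)" and M: "?M \<in> carrier_mat (Suc m) (Suc m)"
    and C: "C \<in> carrier_mat (Suc m) (Suc m)"
    by (auto simp: L_def C_def)
  have C_entry: "C $$ (a, b) = (if a = 0 then B i (case_nat k c b) else neville_step k B (i + a) (case_nat k c b))"
    if "a < Suc m" "b < Suc m" for a b
    using that cleared[of "a - 1"] by (cases a; cases b) (auto simp: C_def)
  have eq: "C = L * ?M"
  proof (rule eq_matI)
    fix a b assume "a < dim_row (L * ?M)" "b < dim_col (L * ?M)"
    then have ab: "a < Suc m" "b < Suc m" using L by auto
    have "(L * ?M) $$ (a, b) = (\<Sum>r<Suc m. L $$ (a, r) * ?M $$ (r, b))"
      using ab L by (simp add: scalar_prod_def atLeast0LessThan)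
    also have "\<dots> = (\<Sum>r\<in>(if a = 0 then {0} else {a, a - 1}). L $$ (a, r) * ?M $$ (r, b))"
      using ab by (intro sum.mono_neutral_right) (auto simp: L_def split: if_splits)
    also have "\<dots> = C $$ (a, b)"
      using ab \<open>k \<le> i\<close> unfolding C_entry[OF ab]
      by (cases a) (auto simp: L_def neville_step_def)
    finally show "C $$ (a, b) = (L * ?M) $$ (a, b)" by simp
  qed (use L C in auto)
  have "Determinant.det L = prod_list (diag_mat L)"
    by (rule det_lower_triangular[OF _ L]) (auto simp: L_def)
  also have "diag_mat L = map (\<lambda>_. 1) [0..<Suc m]"
    unfolding diag_mat_def using L by (intro map_cong) (auto simp: L_def)
  also have "prod_list \<dots> = 1"
    unfolding map_replicate_const by (simp del: upt_Suc)
  finally have "Determinant.det ?M = Determinant.det C"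
    unfolding eq det_mult[OF L M] by simp
  also have "\<dots> = Determinant.det (Matrix.mat 1 1 (\<lambda>_. B i k)) * Determinant.det ?D"
    unfolding C_def by (rule det_four_block_mat_lower_left_zero_col) auto
  also have "Determinant.det (Matrix.mat 1 1 (\<lambda>_. B i k)) = B i k"
    by (subst det_single) auto
  finally show ?thesis .
qed

lemma neville_step_cleared:
  assumes "contiguous_minors_nonneg N k B" "\<And>n. n \<le> N \<Longrightarrow> B n n = 1" "k < n" "n \<le> N"
  shows "neville_step k B n k = 0"
  using neville_zero_propagates[OF assms(1,2,3,4)] assms(3)
  by (cases "B (n - 1) k = 0") (auto simp: neville_step_def neville_mult_def)

text \<open>If the pivot \<open>B (i - 1) k\<close> is positive, adjoining row \<open>i - 1\<close>
  and column \<open>k\<close> gives an old minor equal to the pivot times the new one. If it is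
  zero, nothing is subtracted from these rows.\<close>

lemma neville_step_contiguous_minors:
  assumes minors: "contiguous_minors_nonneg N k B" and diag: "\<And>n. n \<le> N \<Longrightarrow> B n n = 1"
  shows "contiguous_minors_nonneg N (Suc k) (neville_step k B)"
  unfolding contiguous_minors_nonneg_def
proof (intro allI impI, elim conjE)
  fix m i c
  assume i: "Suc k \<le> i" "i + m \<le> Suc N" and mono: "strict_mono_on {..<m} c"
    and c: "\<forall>a<m. Suc k \<le> c a \<and> c a \<le> N"
  let ?D = "Matrix.mat m m (\<lambda>(a, b). neville_step k B (i + a) (c b))"
  show "Determinant.det ?D \<ge> 0"
  proof (cases "B (i - 1) k = 0")
    case True
    \<comment> \<open>The zero runs down column \<open>k\<close>, so every multiplier for the rows
      of this minor is a division by zero, with value 0.\<close>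
    have zero: "B (i - 1 + a) k = 0" if "a \<le> m" for a
      using that
    proof (induction a)
      case (Suc a)
      then show ?case
        using neville_zero_propagates[OF minors diag, of "i + a"] i by (cases i) auto
    qed (use True in simp)
    have "?D = Matrix.mat m m (\<lambda>(a, b). B (i + a) (c b))"
      using zero i by (intro cong_mat) (auto simp: neville_step_def neville_mult_def)
    moreover have "Determinant.det (Matrix.mat m m (\<lambda>(a, b). B (i + a) (c b))) \<ge> 0"
      using i mono c by (intro contiguous_minors_nonnegD[OF minors]) auto
    ultimately show ?thesis by simp
  next
    case False
    show ?thesis
    proof (cases "m = 0")
      case False
      obtain i' where i': "i = Suc i'" using i by (cases i) auto
      have "strict_mono_on {..<Suc m} (case_nat k c)"
        using c by (intro strict_mono_onI)
          (auto simp: Suc_le_eq split: nat.splits intro: strict_mono_onD[OF mono])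
      then have "Determinant.det (Matrix.mat (Suc m) (Suc m) (\<lambda>(a, b). B (i' + a) (case_nat k c b))) \<ge> 0"
        using i i' c mono False by (intro contiguous_minors_nonnegD[OF minors]) (auto split: nat.splits)
      also have "Determinant.det (Matrix.mat (Suc m) (Suc m) (\<lambda>(a, b). B (i' + a) (case_nat k c b)))
          = B i' k * Determinant.det ?D"
        unfolding i' by (rule neville_minor) (use i i' in \<open>auto intro!: neville_step_cleared[OF minors diag]\<close>)
      finally have "B i' k * Determinant.det ?D \<ge> 0" .
      moreover have "B i' k > 0"
        using contiguous_minors_nonneg_entry[OF minors, of i' k] i i' False \<open>B (i - 1) k \<noteq> 0\<close> by auto
      ultimately show ?thesis by (simp add: zero_le_mult_iff)
    qed (simp add: det_dim_zero[of _ ])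
  qed
qed

primrec neville :: "(nat \<Rightarrow> nat \<Rightarrow> real) \<Rightarrow> nat \<Rightarrow> nat \<Rightarrow> nat \<Rightarrow> real" where
  "neville A 0 = A"
| "neville A (Suc k) = neville_step k (neville A k)"

text \<open>Row \<open>n\<close> is changed only by the steps \<open>k < n\<close>, after which it
  is the \<open>n\<close>th unit vector. This is what makes \<open>q n n = p n\<close>
  below.\<close>

lemma neville_invariant:
  assumes "contiguous_minors_nonneg N 0 A"
    and "\<And>n. n \<le> N \<Longrightarrow> A n n = 1" "\<And>n j. n \<le> N \<Longrightarrow> n < j \<Longrightarrow> A n j = 0"
  shows "contiguous_minors_nonneg N k (neville A k) \<and> (\<forall>n\<le>N. neville A k n n = 1) \<and>
    (\<forall>n\<le>N. \<forall>j>n. neville A k n j = 0) \<and> (\<forall>n\<le>N. \<forall>j<k. k \<le> n \<longrightarrow> neville A k n j = 0)"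
proof (induction k)
  case 0
  then show ?case using assms by simp
next
  case (Suc k)
  let ?B = "neville A k"
  have IH: "contiguous_minors_nonneg N k ?B" "\<And>n. n \<le> N \<Longrightarrow> ?B n n = 1"
    "\<And>n j. n \<le> N \<Longrightarrow> n < j \<Longrightarrow> ?B n j = 0"
    "\<And>n j. n \<le> N \<Longrightarrow> j < k \<Longrightarrow> k \<le> n \<Longrightarrow> ?B n j = 0"
    using Suc.IH by auto
  have "neville A (Suc k) n j = 0" if "n \<le> N" "j < Suc k" "Suc k \<le> n" for n j
  proof (cases "j = k")
    case True
    then show ?thesis using neville_step_cleared[OF IH(1,2)] that by simp
  next
    case False
    then show ?thesis using that IH(4)[of n j] IH(4)[of "n - 1" j]
      by (auto simp: neville_step_def)
  qed
  moreover have "neville A (Suc k) n n = 1" "j > n \<Longrightarrow> neville A (Suc k) n j = 0" if "n \<le> N" for n j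
    using that IH(2,3) by (auto simp: neville_step_def)
  ultimately show ?case
    using neville_step_contiguous_minors[OF IH(1,2)] by simp
qed

text \<open>Neville elimination clears the columns one at a time, subtracting from every row a nonnegative
  multiple of the row above. Applied to the vectors \<open>p\<close>, its stages form the array \<open>q\<close>.\<close>

lemma neville_resolution:
  fixes A :: "nat \<Rightarrow> nat \<Rightarrow> real" and p :: "nat \<Rightarrow> 'a::real_field" and z :: 'a
  assumes minors: "contiguous_minors_nonneg N 0 A"
    and diag: "\<And>n. n \<le> N \<Longrightarrow> A n n = 1" and tri: "\<And>n j. n \<le> N \<Longrightarrow> n < j \<Longrightarrow> A n j = 0"
    and sub: "\<And>n. n < N \<Longrightarrow> A (Suc n) n > 0"
    and rec: "\<And>n. n < N \<Longrightarrow> p (Suc n) = z * (\<Sum>k\<le>n. of_real (A (Suc n) k) * p k)"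
  obtains l :: "nat \<Rightarrow> nat \<Rightarrow> real" and q :: "nat \<Rightarrow> nat \<Rightarrow> 'a" where
    "\<And>n k. n < N \<Longrightarrow> k \<le> n \<Longrightarrow> l n k \<ge> 0"
    "\<And>n. n < N \<Longrightarrow> \<exists>k\<le>n. l n k > 0"
    "\<And>n. n \<le> N \<Longrightarrow> q n n = p n"
    "\<And>n k. n < N \<Longrightarrow> k \<le> Suc n \<Longrightarrow>
       q (Suc n) k = z * (\<Sum>j\<le>n. of_real (l n j) * q n j) + (\<Sum>j=k..n. of_real (l n j) * q n j)"
proof -
  note inv = neville_invariant[OF minors diag tri]
  define l where "l n k = neville_mult k (neville A k) (Suc n)" for n k
  define q where "q n k = (\<Sum>j\<le>n. of_real (neville A k n j) * p j)" for n k
  have l_nonneg: "l n k \<ge> 0" if "n < N" "k \<le> n" for n k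
    unfolding l_def neville_mult_def using that
    by (intro divide_nonneg_nonneg contiguous_minors_nonneg_entry[OF conjunct1[OF inv[of k]]]) auto
  have step: "neville A k (Suc n) j = neville A (Suc k) (Suc n) j + l n k * neville A k n j"
    if "k \<le> n" for n k j
    using that by (simp add: neville_step_def l_def)
  have q_step: "q (Suc n) k = q (Suc n) (Suc k) + of_real (l n k) * q n k" if "n < N" "k \<le> n" for n k
  proof -
    have "q (Suc n) k = (\<Sum>j\<le>Suc n. of_real (neville A (Suc k) (Suc n) j) * p j
        + of_real (l n k) * (of_real (neville A k n j) * p j))"
      unfolding q_def by (intro sum.cong refl, subst step[OF that(2)]) (simp add: algebra_simps)
    also have "\<dots> = q (Suc n) (Suc k) + of_real (l n k) * (\<Sum>j\<le>Suc n. of_real (neville A k n j) * p j)"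
      unfolding q_def by (simp only: sum.distrib sum_distrib_left)
    \<comment> \<open>Row \<open>n\<close> vanishes to the right of the diagonal, so the term
      \<open>j = Suc n\<close> drops out.\<close>
    also have "(\<Sum>j\<le>Suc n. of_real (neville A k n j) * p j) = q n k"
      using inv[of k] that unfolding q_def by simp
    finally show ?thesis .
  qed
  have q_diag: "q n n = p n" if "n \<le> N" for n
  proof -
    have "q n n = (\<Sum>j\<in>{n}. of_real (neville A n n j) * p j)"
      unfolding q_def using inv[of n] that by (intro sum.mono_neutral_right) auto
    then show ?thesis using inv[of n] that by simp
  qed
  \<comment> \<open>If all weights vanished, row \<open>Suc n\<close> would never change, and its
    entry in column \<open>n\<close> would stay \<open>A (Suc n) n > 0\<close>, although the
    elimination clears it.\<close>
  have l_pos: "\<exists>k\<le>n. l n k > 0" if "n < N" for n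
  proof (rule ccontr)
    assume "\<not> ?thesis"
    then have l0: "l n k = 0" if "k \<le> n" for k
      using l_nonneg[OF \<open>n < N\<close> that] that by force
    have "neville A k (Suc n) n = A (Suc n) n" if "k \<le> Suc n" for k
      using that
    proof (induction k)
      case (Suc k)
      then show ?case using step[of k n n] l0[of k] by simp
    qed simp
    from this[of "Suc n"] show False
      using inv[of "Suc n"] that sub[OF that] by auto
  qed
  \<comment> \<open>This telescopes \<open>q_step\<close> from \<open>k\<close> up to the
    diagonal.\<close>
  have partial: "q (Suc n) k = p (Suc n) + (\<Sum>j=k..n. of_real (l n j) * q n j)"
    if "n < N" "k \<le> Suc n" for n k
    using that(2)
  proof (induction k rule: inc_induct)
    case base
    then show ?case using q_diag[of "Suc n"] that by simp
  next
    case (step k)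
    then have "{k..n} = insert k {Suc k..n}" by auto
    then show ?case using q_step[of n k] step that by (simp add: add_ac)
  qed
  \<comment> \<open>By the unit diagonal, \<open>q (Suc n) 0\<close> is \<open>p (Suc n)\<close>
    plus the sum in the recurrence. Multiplying it by \<open>z\<close> and comparing with
    \<open>partial\<close> at \<open>k = 0\<close> cancels \<open>z * p (Suc n)\<close>.\<close>
  have "p (Suc n) = z * (\<Sum>j\<le>n. of_real (l n j) * q n j)" if "n < N" for n
  proof -
    have "z * q (Suc n) 0 = z * p (Suc n) + p (Suc n)"
      unfolding q_def using diag[of "Suc n"] that rec[OF that] by (simp add: algebra_simps)
    then show ?thesis
      using partial[OF that, of 0] by (simp add: algebra_simps atLeast0AtMost)
  qed
  then show ?thesis
    using that[of l q] l_nonneg l_pos q_diag partial by simp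
qed

section \<open>Values in the upper half plane\<close>

lemma Im_mult_cnj_flip: "Im (a * cnj b) = - Im (b * cnj a)"
  by simp

text \<open>In terms of arguments in \<open>(0, pi)\<close>, the hypotheses say
  \<open>arg (1 + z) \<le> arg a \<le> arg b \<le> arg z\<close>, which bounds
  \<open>arg b - arg a\<close> as required. To avoid \<open>arg\<close>, the proof writes
  \<open>a = s * b + r\<close> and \<open>b = s * a - r\<close> with real
  \<open>s, r \<ge> 0\<close> and expands.\<close>

lemma sector_pair:
  fixes z a b :: complex
  assumes z: "Im z > 0" and a: "Im a > 0" and b: "Im b > 0"
    and ba: "Im (b * cnj a) \<ge> 0" and zb: "Im (z * cnj b) \<ge> 0" and az: "Im (a * cnj (1 + z)) \<ge> 0"
  shows "Im (z * a * cnj b) \<ge> 0" "Im ((1 + z) * b * cnj a) \<ge> 0"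
proof -
  define s r where "s = Im a / Im b" and "r = Im (b * cnj a) / Im b"
  have a_eq: "a = of_real s * b + of_real r"
    using b by (simp add: complex_eq_iff s_def r_def field_simps)
  have "Im (z * a * cnj b) = s * ((cmod b)\<^sup>2 * Im z) + r * Im (z * cnj b)"
    unfolding cmod_power2 by (subst a_eq) (simp add: algebra_simps power2_eq_square)
  moreover have "s \<ge> 0" "r \<ge> 0" using a b ba by (auto simp: s_def r_def)
  ultimately show "Im (z * a * cnj b) \<ge> 0"
    using z zb by simp
next
  define s r where "s = Im b / Im a" and "r = Im (b * cnj a) / Im a"
  have b_eq: "b = of_real s * a - of_real r"
    using a by (simp add: complex_eq_iff s_def r_def field_simps)
  have "Im ((1 + z) * b * cnj a) = s * ((cmod a)\<^sup>2 * Im z) + r * Im (a * cnj (1 + z))"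
    unfolding cmod_power2 by (subst b_eq) (simp add: algebra_simps power2_eq_square)
  moreover have "s \<ge> 0" "r \<ge> 0" using a b ba by (auto simp: s_def r_def)
  ultimately show "Im ((1 + z) * b * cnj a) \<ge> 0"
    using z az by simp
qed

lemma Im_sum_cnj_sum_nonneg:
  assumes "\<And>a b. a \<in> A \<Longrightarrow> b \<in> B \<Longrightarrow> Im (c * f a * cnj (g b)) \<ge> 0"
  shows "Im (c * sum f A * cnj (sum g B)) \<ge> 0"
  using assms by (simp only: sum_distrib_left sum_distrib_right cnj_sum Im_sum) (auto intro!: sum_nonneg)

lemma Im_mult_norm_square: "Im (c * (w * cnj w)) = (cmod w)\<^sup>2 * Im c"
  unfolding cmod_power2 by (simp add: algebra_simps power2_eq_square)

text \<open>Read with \<open>arg\<close>: the values \<open>f 0, \<dots>, f n\<close> are in the order of increasing arguments, and the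
  differences of these arguments are at most \<open>arg z\<close> and \<open>\<pi> - arg (1 + z)\<close>.\<close>

definition sector_ordered :: "complex \<Rightarrow> nat \<Rightarrow> (nat \<Rightarrow> complex) \<Rightarrow> bool" where
  "sector_ordered z n f \<longleftrightarrow> (\<forall>j k. j \<le> k \<and> k \<le> n \<longrightarrow>
     Im (f k * cnj (f j)) \<ge> 0 \<and> Im (z * f j * cnj (f k)) \<ge> 0 \<and> Im ((1 + z) * f k * cnj (f j)) \<ge> 0)"

lemma sector_orderedD:
  assumes "sector_ordered z n f" "j \<le> k" "k \<le> n"
  shows "Im (f k * cnj (f j)) \<ge> 0" "Im (z * f j * cnj (f k)) \<ge> 0" "Im ((1 + z) * f k * cnj (f j)) \<ge> 0"
  using assms unfolding sector_ordered_def by blast+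

lemma sector_ordered_scale:
  assumes "sector_ordered z n f" "\<And>j. j \<le> n \<Longrightarrow> w j \<ge> 0"
  shows "sector_ordered z n (\<lambda>j. of_real (w j) * f j)"
proof -
  have "Im (c * (of_real (w j) * f j) * cnj (of_real (w k) * f k)) = w j * w k * Im (c * f j * cnj (f k))"
    for c j k
    by (simp add: algebra_simps)
  note scale = this this[of 1, simplified mult_1]
  show ?thesis
    unfolding sector_ordered_def
    using sector_orderedD[OF assms(1)] assms(2)
    by (intro allI impI conjI) (simp_all only: scale, auto intro!: mult_nonneg_nonneg)
qed

text \<open>Divided by \<open>S\<close>, the values \<open>h 0, ..., h (Suc n)\<close> run from
  \<open>1 + z\<close> to \<open>z\<close> with increasing arguments. They therefore satisfy the
  hypotheses of \<open>sector_pair\<close>, which bounds the differences of their arguments.\<close>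

lemma sector_ordered_step:
  fixes z :: complex and g :: "nat \<Rightarrow> complex"
  assumes z: "Im z > 0" and g: "sector_ordered z n g" and S_nz: "(\<Sum>j\<le>n. g j) \<noteq> 0"
  defines "S \<equiv> \<Sum>j\<le>n. g j"
  defines "h \<equiv> \<lambda>k. z * S + (\<Sum>j=k..n. g j)"
  shows "sector_ordered z (Suc n) h" and "\<And>k. k \<le> Suc n \<Longrightarrow> Im (h k * cnj S) > 0"
proof -
  note gD = sector_orderedD[OF g]
  have S_split: "S = sum g {..<k} + sum g {k..n}" if "k \<le> Suc n" for k
  proof -
    have "{..n} = {..<k} \<union> {k..n}" using that by auto
    moreover have "sum g ({..<k} \<union> {k..n}) = sum g {..<k} + sum g {k..n}"
      by (rule sum.union_disjoint) auto
    ultimately show ?thesis by (simp add: S_def)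
  qed
  show pos: "Im (h k * cnj S) > 0" if "k \<le> Suc n" for k
  proof -
    \<comment> \<open>Every term of the tail \<open>?Y\<close> comes after every term of the head
      \<open>?X\<close>, so \<open>?Y * cnj ?X\<close> has nonnegative imaginary part. Strictness
      comes from \<open>z * (S * cnj S)\<close>.\<close>
    let ?X = "sum g {..<k}" and ?Y = "sum g {k..n}"
    have S: "S = ?X + ?Y" by (rule S_split[OF that])
    have "cnj S = cnj ?X + cnj ?Y" by (metis S complex_cnj_add)
    then have "h k * cnj S = z * (S * cnj S) + ?Y * (cnj ?X + cnj ?Y)"
      by (simp only: h_def distrib_right mult.assoc)
    then have "h k * cnj S = z * (S * cnj S) + ?Y * cnj ?Y + ?Y * cnj ?X"
      by (simp only: distrib_left add_ac)
    then have "Im (h k * cnj S) = (cmod S)\<^sup>2 * Im z + Im (1 * ?Y * cnj ?X)"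
      using Im_mult_norm_square[of z S] Im_mult_norm_square[of 1 ?Y] by (simp only: plus_complex.sel mult_1) simp
    moreover have "Im (1 * ?Y * cnj ?X) \<ge> 0"
      using gD by (intro Im_sum_cnj_sum_nonneg) auto
    moreover have "(cmod S)\<^sup>2 * Im z > 0" using S_nz z by (simp add: S_def)
    ultimately show ?thesis by simp
  qed
  have mono: "Im (h l * cnj (h k)) \<ge> 0" if "k \<le> l" "l \<le> Suc n" for k l
  proof -
    let ?X = "sum g {..<k}" and ?Y = "sum g {k..<l}" and ?Z = "sum g {l..n}"
    have Yl: "sum g {k..n} = ?Y + ?Z"
    proof -
      have "{k..n} = {k..<l} \<union> {l..n}" using that by auto
      moreover have "sum g ({k..<l} \<union> {l..n}) = ?Y + ?Z"
        by (rule sum.union_disjoint) auto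
      ultimately show ?thesis by simp
    qed
    have S: "S = ?X + ?Y + ?Z" using S_split[of k] Yl that by (simp add: add_ac)
    \<comment> \<open>Passing from \<open>h k\<close> to \<open>h l\<close> removes the middle block
      \<open>?Y\<close>, so it is enough to compare \<open>h k\<close> with \<open>?Y\<close>. In
      \<open>h k\<close> the earlier block \<open>?X\<close> has the factor \<open>z\<close> and the
      later block \<open>?Z\<close> has \<open>1 + z\<close>, as the last two conditions of
      \<open>sector_ordered\<close> demand.\<close>
    have hl: "h l = h k - ?Y" and hk: "h k = z * (?X + ?Y + ?Z) + ?Y + ?Z"
      unfolding h_def Yl S by simp_all
    have "Im (h l * cnj (h k)) = - Im (?Y * cnj (h k))"
      unfolding hl by (simp add: algebra_simps)
    also have "\<dots> = Im (h k * cnj ?Y)"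
      by (rule Im_mult_cnj_flip[symmetric])
    also have "h k * cnj ?Y = z * ?X * cnj ?Y + z * (?Y * cnj ?Y) + z * ?Z * cnj ?Y + ?Y * cnj ?Y + ?Z * cnj ?Y"
      unfolding hk by (simp add: algebra_simps)
    also have "\<dots> = z * ?X * cnj ?Y + z * (?Y * cnj ?Y) + ?Y * cnj ?Y + (1 + z) * ?Z * cnj ?Y"
      by (simp add: algebra_simps)
    also have "Im \<dots> = Im (z * ?X * cnj ?Y) + (cmod ?Y)\<^sup>2 * Im z + Im ((1 + z) * ?Z * cnj ?Y)"
      using Im_mult_norm_square[of z ?Y] Im_mult_norm_square[of 1 ?Y] by (simp only: plus_complex.sel mult_1) simp
    finally have "Im (h l * cnj (h k)) = \<dots>" .
    moreover have "Im (z * ?X * cnj ?Y) \<ge> 0"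
      using gD that by (intro Im_sum_cnj_sum_nonneg) auto
    moreover have "Im ((1 + z) * ?Z * cnj ?Y) \<ge> 0"
      using gD that by (intro Im_sum_cnj_sum_nonneg) auto
    ultimately show ?thesis using z by simp
  qed
  have S0: "S \<noteq> 0" using S_nz by (simp add: S_def)
  define u where "u k = h k / S" for k
  have h_u: "h k = S * u k" for k using S0 by (simp add: u_def)
  have factor: "Im (c * h j * cnj (h k)) = (cmod S)\<^sup>2 * Im (c * u j * cnj (u k))" for c j k
  proof -
    have "c * h j * cnj (h k) = (c * u j * cnj (u k)) * (S * cnj S)"
      by (simp add: h_u algebra_simps)
    then show ?thesis by (simp only: Im_mult_norm_square)
  qed
  have u_pos: "Im (u k) > 0" if "k \<le> Suc n" for k
  proof -
    have "h k * cnj S = u k * (S * cnj S)"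
      by (simp add: h_u)
    then have "Im (h k * cnj S) = (cmod S)\<^sup>2 * Im (u k)" by (simp only: Im_mult_norm_square)
    then show ?thesis using pos[OF that] by (simp add: zero_less_mult_iff)
  qed
  have u_mono: "Im (u l * cnj (u k)) \<ge> 0" if "k \<le> l" "l \<le> Suc n" for k l
    using mono[OF that] factor[of 1 l k] S0 by (simp add: zero_le_mult_iff del: times_complex.sel)
  \<comment> \<open>The tail sum is all of \<open>S\<close> at \<open>k = 0\<close> and empty at
    \<open>k = Suc n\<close>.\<close>
  have u_ends: "u 0 = 1 + z" "u (Suc n) = z"
    using S0 by (simp_all add: u_def h_def S_def atLeast0AtMost field_simps)
  have "Im (z * u k * cnj (u l)) \<ge> 0 \<and> Im ((1 + z) * u l * cnj (u k)) \<ge> 0" if "k \<le> l" "l \<le> Suc n" for k l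
    using sector_pair[OF z u_pos u_pos u_mono[OF that]] u_mono[of l "Suc n"] u_mono[of 0 k] that
    by (simp only: u_ends)
  then show "sector_ordered z (Suc n) h"
    unfolding sector_ordered_def using mono factor by (auto simp del: times_complex.sel)
qed

text \<open>The open half plane described by \<open>c\<close> is carried through the induction
  because a nonnegative, nonzero combination of its points cannot vanish. This supplies
  \<open>S \<noteq> 0\<close> for the next step, whose own witness is \<open>cnj S\<close>.\<close>

lemma resolution_upper_half_plane:
  fixes z :: complex and l :: "nat \<Rightarrow> nat \<Rightarrow> real" and q :: "nat \<Rightarrow> nat \<Rightarrow> complex"
  assumes z: "Im z > 0" and q0: "q 0 0 = 1"
    and l: "\<And>n k. n < N \<Longrightarrow> k \<le> n \<Longrightarrow> l n k \<ge> 0" and l_pos: "\<And>n. n < N \<Longrightarrow> \<exists>k\<le>n. l n k > 0"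
    and q: "\<And>n k. n < N \<Longrightarrow> k \<le> Suc n \<Longrightarrow>
       q (Suc n) k = z * (\<Sum>j\<le>n. of_real (l n j) * q n j) + (\<Sum>j=k..n. of_real (l n j) * q n j)"
    and "n \<le> N"
  shows "sector_ordered z n (q n) \<and> (\<exists>c. \<forall>k\<le>n. Im (q n k * c) > 0)"
  using \<open>n \<le> N\<close>
proof (induction n)
  case 0
  have "Im (q 0 0 * \<i>) > 0" by (simp add: q0)
  then show ?case using z unfolding sector_ordered_def by (auto simp: q0)
next
  case (Suc n)
  then obtain c where IH: "sector_ordered z n (q n)" and c: "\<And>k. k \<le> n \<Longrightarrow> Im (q n k * c) > 0"
    by auto
  have n: "n < N" using Suc by simp
  define g where "g j = of_real (l n j) * q n j" for j
  have g: "sector_ordered z n g"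
    unfolding g_def using l[OF n] by (intro sector_ordered_scale[OF IH])
  have "Im ((\<Sum>j\<le>n. g j) * c) = (\<Sum>j\<le>n. l n j * Im (q n j * c))"
    unfolding sum_distrib_right Im_sum g_def by (intro sum.cong) (auto simp: algebra_simps)
  moreover obtain k where "k \<le> n" "l n k > 0" using l_pos[OF n] by auto
  then have "(\<Sum>j\<le>n. l n j * Im (q n j * c)) > 0"
    using l[OF n] c by (intro sum_pos2[of _ k]) (auto intro!: mult_nonneg_nonneg simp del: times_complex.sel intro: less_imp_le)
  ultimately have "Im ((\<Sum>j\<le>n. g j) * c) \<noteq> 0" by linarith
  then have "(\<Sum>j\<le>n. g j) \<noteq> 0" by (metis mult_zero_left zero_complex.sel(2))
  note step = sector_ordered_step[OF z g this]
  have "q (Suc n) k = z * (\<Sum>j\<le>n. g j) + (\<Sum>j=k..n. g j)" if "k \<le> Suc n" for k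
    using q[OF n that] by (simp add: g_def)
  with step show ?case unfolding sector_ordered_def by (metis le_trans)
qed

text \<open>The real counterpart of the half plane is a common strict sign, recorded by
  \<open>c\<close>. Every tail sum lies between 0 and the full sum, so the new values lie between
  \<open>x\<close> and \<open>x + 1\<close> times the full sum, and these two factors have the same
  sign.\<close>

lemma resolution_real:
  fixes x :: real and l q :: "nat \<Rightarrow> nat \<Rightarrow> real"
  assumes x: "x < -1 \<or> x > 0" and q0: "q 0 0 = 1"
    and l: "\<And>n k. n < N \<Longrightarrow> k \<le> n \<Longrightarrow> l n k \<ge> 0" and l_pos: "\<And>n. n < N \<Longrightarrow> \<exists>k\<le>n. l n k > 0"
    and q: "\<And>n k. n < N \<Longrightarrow> k \<le> Suc n \<Longrightarrow>
       q (Suc n) k = x * (\<Sum>j\<le>n. l n j * q n j) + (\<Sum>j=k..n. l n j * q n j)"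
    and "n \<le> N"
  shows "\<exists>c. \<forall>k\<le>n. q n k * c > 0"
  using \<open>n \<le> N\<close>
proof (induction n)
  case 0
  then show ?case by (auto simp: q0 intro!: exI[of _ 1])
next
  case (Suc n)
  then obtain c where c: "\<And>k. k \<le> n \<Longrightarrow> q n k * c > 0" by auto
  have n: "n < N" using Suc by simp
  define g where "g j = l n j * q n j * c" for j
  have g: "g j \<ge> 0" if "j \<le> n" for j
    using l[OF n that] c[OF that] by (simp add: g_def mult.assoc)
  obtain k where k: "k \<le> n" "l n k > 0" using l_pos[OF n] by auto
  have S: "sum g {..n} > 0"
    using g k c by (intro sum_pos2[of _ k]) (auto simp: g_def mult.assoc)
  have eq: "q (Suc n) k * c = x * sum g {..n} + sum g {k..n}" if "k \<le> Suc n" for k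
    unfolding q[OF n that] g_def by (simp add: distrib_right sum_distrib_right mult.assoc)
  have tail: "0 \<le> sum g {k..n}" "sum g {k..n} \<le> sum g {..n}" for k
    using g by (auto intro!: sum_nonneg sum_mono2)
  show ?case
  proof (cases "x > 0")
    case True
    then show ?thesis using eq tail S by (metis add_pos_nonneg mult_pos_pos)
  next
    case False
    \<comment> \<open>Here the sign flips, so the witness becomes \<open>- c\<close>.\<close>
    have "(x + 1) * sum g {..n} < 0" using x False S by (simp add: mult_neg_pos)
    then have "q (Suc n) k * (- c) > 0" if "k \<le> Suc n" for k
      using eq[OF that] tail(2)[of k] by (simp add: algebra_simps)
    then show ?thesis by blast
  qed
qed

section \<open>Interlacing from the sign of an imaginary part\<close>

abbreviation (input) cpoly :: "real poly \<Rightarrow> complex poly" where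
  "cpoly \<equiv> map_poly complex_of_real"

lemma poly_cpoly_of_real: "poly (cpoly f) (complex_of_real x) = complex_of_real (poly f x)"
  by (induction f) (simp_all add: map_poly_pCons)

text \<open>The polynomial splits over the complex numbers with real roots, collected in
  \<open>M\<close>. Agreement at all real points gives the same factorization over the reals, which
  identifies \<open>M\<close> with \<open>proots f\<close>.\<close>

lemma real_rooted_factorization:
  assumes "f \<noteq> 0" "real_rooted f"
  shows "size (proots f) = degree f"
    and "poly (cpoly f) z = of_real (lead_coeff f) * (\<Prod>a\<in>#proots f. z - of_real a)"
proof -
  define M where "M = image_mset Re (proots (cpoly f))"
  have nz: "cpoly f \<noteq> 0" and deg: "degree (cpoly f) = degree f"
    using assms(1) by (simp_all add: map_poly_eq_0_iff degree_map_poly)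
  have roots: "proots (cpoly f) = image_mset of_real M"
  proof -
    have "image_mset (\<lambda>z. of_real (Re z)) (proots (cpoly f)) = image_mset (\<lambda>z. z) (proots (cpoly f))"
      using assms(2) nz by (intro image_mset_cong) (auto simp: real_rooted_def of_real_Re)
    then show ?thesis by (simp add: M_def multiset.map_comp comp_def)
  qed
  have eval: "poly (cpoly f) w = of_real (lead_coeff f) * (\<Prod>a\<in>#M. w - of_real a)" for w
    by (subst complex_poly_decompose_multiset[symmetric])
      (simp add: roots poly_prod_mset multiset.map_comp comp_def deg coeff_map_poly)
  let ?g = "Polynomial.smult (lead_coeff f) (\<Prod>a\<in>#M. [:-a, 1:])"
  have "poly f x = poly ?g x" for x
  proof -
    have "complex_of_real (poly f x) = of_real (lead_coeff f) * (\<Prod>a\<in>#M. of_real x - of_real a)"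
      using eval[of "of_real x"] by (simp add: poly_cpoly_of_real)
    also have "(\<Prod>a\<in>#M. of_real x - complex_of_real a) = of_real (\<Prod>a\<in>#M. x - a)"
      by (induction M) simp_all
    finally show ?thesis
      by (simp add: poly_prod_mset flip: of_real_mult)
  qed
  then have "poly f = poly ?g" by (intro ext)
  then have "f = ?g" by (simp only: poly_eq_poly_eq_iff)
  then have "proots f = proots (\<Prod>a\<in>#M. [:-a, 1:])"
    using assms(1) by (metis leading_coeff_0_iff proots_smult)
  also have "\<dots> = M"
  proof (induction M)
    case (add a M)
    have "(\<Prod>a\<in>#M. [:-a, 1:]) \<noteq> 0" by (auto simp: prod_mset_zero_iff)
    then have "proots ([:-a, 1:] * (\<Prod>a\<in>#M. [:-a, 1:])) = {#a#} + M"
      by (subst proots_mult) (auto simp: add)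
    then show ?case by simp
  qed simp
  finally have "proots f = M" .
  with eval size_proots_complex[of "cpoly f"] roots deg show
    "size (proots f) = degree f"
    "poly (cpoly f) z = of_real (lead_coeff f) * (\<Prod>a\<in>#proots f. z - of_real a)"
    by auto
qed

section \<open>Arguments on vertical lines and numbers of zeros\<close>

text \<open>For \<open>y > 0\<close> this is the sum of the arguments in \<open>(0, \<pi>)\<close> of the numbers \<open>x + \<i>y - a\<close>.\<close>

definition total_arg :: "real multiset \<Rightarrow> real \<Rightarrow> real \<Rightarrow> real" where
  "total_arg M x y = (\<Sum>a\<in>#M. pi / 2 - arctan ((x - a) / y))"

lemma total_arg_empty: "total_arg {#} x = (\<lambda>_. 0)"
  by (simp add: total_arg_def fun_eq_iff)

lemma total_arg_add_mset:
  "total_arg (add_mset a M) x = (\<lambda>y. pi / 2 - arctan ((x - a) / y) + total_arg M x y)"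
  by (simp add: total_arg_def fun_eq_iff)

text \<open>Each factor is \<open>y * (u + i)\<close> with \<open>u = (x - a) / y\<close>, of
  modulus \<open>y * sqrt (1 + u^2)\<close> and argument \<open>pi / 2 - arctan u\<close>. Arguments
  add under products; not reducing them modulo \<open>2 * pi\<close> keeps the sum continuous in
  \<open>y\<close>.\<close>

lemma prod_mset_total_arg:
  assumes "y > 0"
  shows "\<exists>r>0. (\<Prod>a\<in>#M. Complex x y - of_real a) = rcis r (total_arg M x y)"
proof (induction M)
  case empty
  then show ?case by (intro exI[of _ 1]) (simp add: total_arg_def)
next
  case (add a M)
  then obtain r where r: "r > 0" "(\<Prod>a\<in>#M. Complex x y - of_real a) = rcis r (total_arg M x y)"
    by auto
  define u where "u = (x - a) / y"
  have "sqrt (1 + u\<^sup>2) > 0" by (simp add: add_pos_nonneg)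
  have "Complex x y - of_real a = rcis (y * sqrt (1 + u\<^sup>2)) (pi / 2 - arctan u)"
    using assms \<open>sqrt (1 + u\<^sup>2) > 0\<close>
    by (simp add: complex_eq_iff cos_diff sin_diff cos_arctan sin_arctan) (simp add: u_def)
  with r show ?case
    using assms \<open>sqrt (1 + u\<^sup>2) > 0\<close>
    by (intro exI[of _ "y * sqrt (1 + u\<^sup>2) * r"]) (simp add: rcis_mult total_arg_def u_def)
qed

lemma continuous_on_total_arg: "continuous_on {0<..} (total_arg M x)"
proof (induction M)
  case (add a M)
  have "continuous_on {0<..} (\<lambda>y. pi / 2 - arctan ((x - a) / y) + total_arg M x y)"
    by (intro continuous_intros add) auto
  then show ?case by (simp only: total_arg_add_mset)
qed (simp add: total_arg_empty)

lemma total_arg_at_top: "(total_arg M x \<longlongrightarrow> pi / 2 * size M) at_top"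
proof (induction M)
  case (add a M)
  have "((\<lambda>y. (x - a) / y) \<longlongrightarrow> 0) at_top"
    by (intro real_tendsto_divide_at_top[OF tendsto_const] filterlim_ident)
  then have "((\<lambda>y. pi / 2 - arctan ((x - a) / y) + total_arg M x y)
      \<longlongrightarrow> pi / 2 - arctan 0 + pi / 2 * size M) at_top"
    by (intro tendsto_intros add)
  moreover have "pi / 2 - arctan 0 + pi / 2 * size M = pi / 2 * size (add_mset a M)"
    by (simp add: field_simps)
  ultimately show ?case by (simp only: total_arg_add_mset)
qed (simp add: total_arg_empty)

text \<open>A zero to the right of \<open>x\<close> contributes \<open>pi\<close> in the limit and a
  zero to the left contributes 0. A zero at \<open>x\<close> would contribute \<open>pi / 2\<close>,
  hence the assumption.\<close>

lemma total_arg_at_0: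
  assumes "x \<notin># M"
  shows "(total_arg M x \<longlongrightarrow> pi * size (filter_mset (\<lambda>a. a > x) M)) (at_right 0)"
  using assms
proof (induction M)
  case (add a M)
  have inf: "filterlim (\<lambda>y::real. inverse y) at_top (at_right 0)"
    by (rule filterlim_inverse_at_top_right)
  have "((\<lambda>y. arctan ((x - a) / y)) \<longlongrightarrow> (if a > x then - (pi / 2) else pi / 2)) (at_right 0)"
  proof (cases "a > x")
    case True
    then have "filterlim (\<lambda>y. (x - a) / y) at_bot (at_right 0)"
      unfolding divide_inverse by (intro filterlim_tendsto_neg_mult_at_bot[OF tendsto_const _ inf]) auto
    then show ?thesis
      using True filterlim_compose[OF tendsto_arctan_at_bot] by auto
  next
    case False
    then have "x - a > 0" using add.prems by auto
    then have "filterlim (\<lambda>y. (x - a) / y) at_top (at_right 0)"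
      unfolding divide_inverse by (intro filterlim_tendsto_pos_mult_at_top[OF tendsto_const _ inf]) auto
    then show ?thesis
      using False filterlim_compose[OF tendsto_arctan_at_top] by auto
  qed
  then have "((\<lambda>y. pi / 2 - arctan ((x - a) / y) + total_arg M x y)
      \<longlongrightarrow> pi / 2 - (if a > x then - (pi / 2) else pi / 2) + pi * size (filter_mset (\<lambda>a. a > x) M)) (at_right 0)"
    using add by (intro tendsto_intros) auto
  moreover have "pi / 2 - (if a > x then - (pi / 2) else pi / 2) + pi * size (filter_mset (\<lambda>a. a > x) M)
      = pi * size (filter_mset (\<lambda>a. a > x) (add_mset a M))"
    by (simp add: field_simps)
  ultimately show ?case by (simp only: total_arg_add_mset)
qed (simp add: total_arg_empty)

text \<open>On each vertical line in the upper half plane the difference of the total arguments of \<open>g\<close> and \<open>f\<close>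
  is continuous, tends to \<open>\<pi> / 2\<close> at infinity and has nonnegative sine, so it stays in \<open>[0, \<pi>]\<close>.
  Near the real axis it is \<open>\<pi>\<close> times the difference of the numbers of zeros to the right.\<close>

lemma zero_counts_of_sector:
  fixes F G :: "real multiset"
  assumes size: "size G = Suc (size F)"
    and pos: "\<And>z. Im z > 0 \<Longrightarrow> Im ((\<Prod>a\<in>#G. z - of_real a) * cnj (\<Prod>a\<in>#F. z - of_real a)) \<ge> 0"
    and x: "x \<notin># F" "x \<notin># G"
  defines "n_above \<equiv> \<lambda>M. size (filter_mset (\<lambda>a. a > x) M)"
  shows "n_above F \<le> n_above G" "n_above G \<le> Suc (n_above F)"
proof -
  define h where "h y = total_arg G x y - total_arg F x y" for y
  have sin_h: "sin (h y) \<ge> 0" if y: "y > 0" for y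
  proof -
    obtain r s where "r > 0" "s > 0"
      and r: "(\<Prod>a\<in>#G. Complex x y - of_real a) = rcis r (total_arg G x y)"
      and s: "(\<Prod>a\<in>#F. Complex x y - of_real a) = rcis s (total_arg F x y)"
      using prod_mset_total_arg[OF y] by metis
    have "Im (rcis r (total_arg G x y) * cnj (rcis s (total_arg F x y))) = r * s * sin (h y)"
      by (simp add: h_def sin_diff algebra_simps)
    moreover have "Im (rcis r (total_arg G x y) * cnj (rcis s (total_arg F x y))) \<ge> 0"
      using pos[of "Complex x y"] y unfolding r s by simp
    ultimately have "r * s * sin (h y) \<ge> 0" by simp
    then show ?thesis using mult_pos_pos[OF \<open>r > 0\<close> \<open>s > 0\<close>] by (simp only: zero_le_mult_iff) linarith
  qed
  have "connected (h ` {0<..})"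
    unfolding h_def by (intro connected_continuous_image continuous_intros continuous_on_total_arg) auto
  then have interval: "t \<in> h ` {0<..}" if "a \<in> h ` {0<..}" "b \<in> h ` {0<..}" "a \<le> t" "t \<le> b" for a b t
    using that unfolding connected_iff_interval by blast
  have "(h \<longlongrightarrow> pi / 2 * size G - pi / 2 * size F) at_top"
    unfolding h_def by (intro tendsto_diff total_arg_at_top)
  \<comment> \<open>The sizes differ by one, which leaves a single \<open>pi / 2\<close>.\<close>
  then have lim: "(h \<longlongrightarrow> pi / 2) at_top"
    by (simp add: size add_divide_distrib distrib_left)
  have "eventually (\<lambda>y. h y > 0) at_top" "eventually (\<lambda>y. h y < pi) at_top"
    by (rule order_tendstoD[OF lim]; simp)+
  then have "eventually (\<lambda>y. h y > 0 \<and> h y < pi \<and> y > 0) at_top"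
    using eventually_gt_at_top[of "0::real"]
    by eventually_elim auto
  then obtain b where b: "h b > 0" "h b < pi" "b > 0"
    by (auto simp: eventually_at_top_linorder)
  have range: "0 \<le> h y \<and> h y \<le> pi" if y: "y > 0" for y
  proof (rule ccontr)
    assume "\<not> ?thesis"
    have hy: "h y \<in> h ` {0<..}" and hb: "h b \<in> h ` {0<..}" using y b(3) by auto
    from \<open>\<not> ?thesis\<close> consider "h y < 0" | "h y > pi" by linarith
    then obtain t where t: "t \<in> h ` {0<..}" "sin t < 0"
    \<comment> \<open>If \<open>h\<close> left \<open>[0, pi]\<close>, then by connectedness it
      would take a value in \<open>[- pi / 2, 0)\<close> or in \<open>(pi, 3 * pi / 2]\<close>,
      where the sine is negative.\<close>
    proof cases
      case 1
      have "max (h y) (- pi / 2) \<in> h ` {0<..}"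
        by (rule interval[OF hy hb]) (use 1 b in auto)
      moreover have "- max (h y) (- pi / 2) < pi"
        using max.cobounded2[of "- pi / 2" "h y"] pi_gt_zero by linarith
      then have "sin (max (h y) (- pi / 2)) < 0"
        using 1 sin_gt_zero[of "- max (h y) (- pi / 2)"] by (simp add: max_less_iff_conj)
      ultimately show ?thesis by (rule that)
    next
      case 2
      have "min (h y) (3 * pi / 2) \<in> h ` {0<..}"
        by (rule interval[OF hb hy]) (use 2 b in auto)
      moreover have "min (h y) (3 * pi / 2) < 2 * pi"
        using min.cobounded2[of "h y" "3 * pi / 2"] pi_gt_zero by linarith
      then have "sin (min (h y) (3 * pi / 2)) < 0"
        by (intro sin_lt_zero) (use 2 in simp_all)
      ultimately show ?thesis by (rule that)
    qed
    then show False using sin_h by force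
  qed
  have lim0: "(h \<longlongrightarrow> pi * n_above G - pi * n_above F) (at_right 0)"
    unfolding h_def n_above_def by (intro tendsto_diff total_arg_at_0 x)
  have ev: "eventually (\<lambda>y. 0 \<le> h y) (at_right 0)" "eventually (\<lambda>y. h y \<le> pi) (at_right 0)"
    using range by (auto simp: eventually_at_filter)
  have "0 \<le> pi * n_above G - pi * n_above F"
    using tendsto_lowerbound[OF lim0 ev(1)] by simp
  then have "pi * n_above F \<le> pi * n_above G" by simp
  then show "n_above F \<le> n_above G" by simp
  have "pi * n_above G - pi * n_above F \<le> pi"
    using tendsto_upperbound[OF lim0 ev(2)] by simp
  then have "pi * n_above G \<le> pi * (1 + n_above F)" by (simp add: algebra_simps)
  then show "n_above G \<le> Suc (n_above F)" by (simp del: of_nat_Suc add: mult_le_cancel_left_pos)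
qed

section \<open>From numbers of zeros to interlacing\<close>

text \<open>In a descending list the entries above \<open>x\<close> form an initial segment.\<close>

lemma nth_gt_iff_less_count:
  fixes xs :: "real list"
  assumes "sorted_wrt (\<ge>) xs"
  shows "i < size (filter_mset (\<lambda>a. a > x) (mset xs)) \<longleftrightarrow> i < length xs \<and> xs ! i > x"
  using assms
proof (induction xs arbitrary: i)
  case (Cons a xs)
  show ?case
  proof (cases "a > x")
    case True
    then show ?thesis using Cons by (cases i) auto
  next
    case False
    then have small: "\<And>b. b \<in> set (a # xs) \<Longrightarrow> b \<le> x" using Cons.prems by fastforce
    then have "filter_mset (\<lambda>a. a > x) (mset (a # xs)) = {#}"
      by (simp only: filter_mset_eq_conv) (force simp: not_less)
    moreover have "\<not> (a # xs) ! i > x" if "i < length (a # xs)"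
      using small[OF nth_mem[OF that]] by simp
    ultimately show ?thesis by auto
  qed
qed simp

lemma zeros_desc_properties:
  "sorted_wrt (\<ge>) (zeros_desc f)" "mset (zeros_desc f) = proots f" "length (zeros_desc f) = size (proots f)"
  unfolding zeros_desc_def using sorted_sorted_list_of_multiset[of "proots f"]
  by (simp_all add: sorted_wrt_rev flip: size_mset)

text \<open>Were one of the index inequalities violated, a point \<open>x\<close> strictly between
  the two zeros would have numbers of zeros above it that contradict
  \<open>zero_counts_of_sector\<close>.\<close>

lemma interlacesI:
  fixes f g :: "real poly"
  assumes f: "real_rooted f" "lead_coeff f > 0" and g: "real_rooted g" "lead_coeff g > 0"
    and deg: "degree g = Suc (degree f)"
    and pos: "\<And>z. Im z > 0 \<Longrightarrow> Im (poly (cpoly g) z * cnj (poly (cpoly f) z)) \<ge> 0"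
  shows "interlaces f g"
proof -
  let ?F = "proots f" and ?G = "proots g"
  let ?a = "zeros_desc f" and ?b = "zeros_desc g"
  have nz: "f \<noteq> 0" "g \<noteq> 0" using f(2) g(2) by auto
  note Ff = real_rooted_factorization[OF nz(1) f(1)] and Gf = real_rooted_factorization[OF nz(2) g(1)]
  have size: "size ?G = Suc (size ?F)" using Ff(1) Gf(1) deg by simp
  have pos': "Im ((\<Prod>a\<in>#?G. z - of_real a) * cnj (\<Prod>a\<in>#?F. z - of_real a)) \<ge> 0" if "Im z > 0" for z
  proof -
    let ?p = "\<Prod>a\<in>#?G. z - complex_of_real a" and ?q = "\<Prod>a\<in>#?F. z - complex_of_real a"
    have "poly (cpoly g) z * cnj (poly (cpoly f) z) =
        of_real (lead_coeff g * lead_coeff f) * (?p * cnj ?q)"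
      unfolding Ff(2) Gf(2) by simp
    then have "Im (poly (cpoly g) z * cnj (poly (cpoly f) z)) =
        lead_coeff g * lead_coeff f * Im (?p * cnj ?q)"
      by (simp only: times_complex.sel Re_complex_of_real Im_complex_of_real)
    then show ?thesis
      using pos[OF that] mult_pos_pos[OF g(2) f(2)] by (simp add: zero_le_mult_iff)
  qed
  have counts: "size (filter_mset (\<lambda>a. a > x) ?F) \<le> size (filter_mset (\<lambda>a. a > x) ?G)"
    "size (filter_mset (\<lambda>a. a > x) ?G) \<le> Suc (size (filter_mset (\<lambda>a. a > x) ?F))"
    if "x \<notin># ?F" "x \<notin># ?G" for x
    using zero_counts_of_sector[OF size _ that] pos' by blast+
  \<comment> \<open>The counts are compared only away from the zeros, which are finite in
    number.\<close>
  have avoid: "\<exists>x. u < x \<and> x < v \<and> x \<notin># ?F \<and> x \<notin># ?G" if "u < v" for u v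
  proof -
    have "infinite ({u<..<v} - (set_mset ?F \<union> set_mset ?G))"
      using that by (intro Diff_infinite_finite) auto
    then obtain x where "x \<in> {u<..<v} - (set_mset ?F \<union> set_mset ?G)"
      using infinite_imp_nonempty by blast
    then show ?thesis by auto
  qed
  note nth_iff = nth_gt_iff_less_count[OF zeros_desc_properties(1), unfolded zeros_desc_properties(2)]
  note len = zeros_desc_properties(3)
  have "?a ! i \<le> ?b ! i" if "i < length ?a" for i
  proof (rule ccontr)
    assume "\<not> ?thesis"
    then obtain x where x: "?b ! i < x" "x < ?a ! i" "x \<notin># ?F" "x \<notin># ?G"
      using avoid[of "?b ! i" "?a ! i"] by (auto simp: not_le)
    have "i < size (filter_mset (\<lambda>a. a > x) ?F)" using x that by (simp add: nth_iff)
    moreover have "\<not> i < size (filter_mset (\<lambda>a. a > x) ?G)" using x by (simp add: nth_iff)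
    ultimately show False using counts(1)[OF x(3,4)] by simp
  qed
  moreover have "?b ! (i + 1) \<le> ?a ! i" if "i + 1 < length ?b" for i
  proof (rule ccontr)
    assume "\<not> ?thesis"
    then obtain x where x: "?a ! i < x" "x < ?b ! (i + 1)" "x \<notin># ?F" "x \<notin># ?G"
      using avoid[of "?a ! i" "?b ! (i + 1)"] by (auto simp: not_le)
    have "i + 1 < size (filter_mset (\<lambda>a. a > x) ?G)" using x that by (simp add: nth_iff)
    moreover have "\<not> i < size (filter_mset (\<lambda>a. a > x) ?F)" using x by (simp add: nth_iff)
    ultimately show False using counts(2)[OF x(3,4)] by simp
  qed
  ultimately show ?thesis
    unfolding interlaces_def Let_def using f g len[of f] len[of g] size by auto
qed

section \<open>Chains in quasi-rank uniform posets\<close>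

lemma sorted_wrt_less_le_last:
  fixes xs :: "'a::order list"
  shows "sorted_wrt (<) xs \<Longrightarrow> a \<in> set xs \<Longrightarrow> a \<le> last xs"
  by (induction xs) (auto intro: less_imp_le)

lemma chains_to_Suc:
  "chains_to P x (Suc k) =
     (if x \<in> P then \<Union>y\<in>{y\<in>P. y < x}. (\<lambda>ys. ys @ [x]) ` chains_to P y k else {})"
proof (intro Set.set_eqI iffI)
  fix xs assume xs: "xs \<in> chains_to P x (Suc k)"
  then have len: "length xs = Suc (Suc k)" and "last xs = x" by (auto simp: chains_to_def)
  then obtain ys where ys: "xs = ys @ [x]" by (metis append_butlast_last_id length_0_conv nat.distinct(1))
  with len have "ys \<noteq> []" by auto
  then have "last ys \<in> set ys" by simp
  with xs ys \<open>ys \<noteq> []\<close> have "x \<in> P" "last ys \<in> P" "last ys < x" "ys \<in> chains_to P (last ys) k"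
    by (auto simp: chains_to_def sorted_wrt_append)
  with ys show "xs \<in> (if x \<in> P then \<Union>y\<in>{y\<in>P. y < x}. (\<lambda>ys. ys @ [x]) ` chains_to P y k else {})"
    by auto
next
  fix xs assume "xs \<in> (if x \<in> P then \<Union>y\<in>{y\<in>P. y < x}. (\<lambda>ys. ys @ [x]) ` chains_to P y k else {})"
  then obtain y ys where "x \<in> P" "y \<in> P" "y < x" "ys \<in> chains_to P y k" "xs = ys @ [x]"
    by (auto split: if_splits)
  then show "xs \<in> chains_to P x (Suc k)"
    using sorted_wrt_less_le_last[of ys]
    by (auto simp: chains_to_def sorted_wrt_append intro: le_less_trans)
qed

lemma chains_to_0: "chains_to P x 0 = (if x \<in> P then {[x]} else {})"
  by (auto simp: chains_to_def length_Suc_conv)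

lemma chains_to_le_quasi_rank:
  assumes "finite_quasi_rank P" "x \<in> P" "chains_to P x k \<noteq> {}"
  shows "k \<le> quasi_rank P x"
  unfolding quasi_rank_def using assms by (intro Max_ge) (auto simp: finite_quasi_rank_def)

lemma chains_to_quasi_rank:
  assumes "finite_quasi_rank P" "x \<in> P"
  shows "chains_to P x (quasi_rank P x) \<noteq> {}"
proof -
  have "quasi_rank P x \<in> {k. chains_to P x k \<noteq> {}}"
    unfolding quasi_rank_def
  proof (rule Max_in)
    show "finite {k. chains_to P x k \<noteq> {}}" using assms by (auto simp: finite_quasi_rank_def)
    have "0 \<in> {k. chains_to P x k \<noteq> {}}" using assms(2) by (simp add: chains_to_0)
    then show "{k. chains_to P x k \<noteq> {}} \<noteq> {}" by blast
  qed
  then show ?thesis by simp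
qed

lemma quasi_rank_less:
  assumes "finite_quasi_rank P" "x \<in> P" "y \<in> P" "y < x"
  shows "quasi_rank P y < quasi_rank P x"
proof -
  have "chains_to P x (Suc (quasi_rank P y)) \<noteq> {}"
    using chains_to_quasi_rank[OF assms(1,3)] assms by (auto simp: chains_to_Suc)
  then show ?thesis
    using chains_to_le_quasi_rank[OF assms(1,2)] by fastforce
qed

text \<open>The last element but one of a longest chain to \<open>x\<close> ends a chain of length
  \<open>n\<close>, so its quasi-rank is at least \<open>n\<close>; it is below \<open>Suc n\<close>
  by strict monotonicity.\<close>

lemma quasi_rank_pred:
  assumes "finite_quasi_rank P" "x \<in> P" "quasi_rank P x = Suc n"
  shows "\<exists>y\<in>P. y < x \<and> quasi_rank P y = n"
proof -
  obtain y where y: "y \<in> P" "y < x" "chains_to P y n \<noteq> {}"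
    using chains_to_quasi_rank[OF assms(1,2)] assms by (auto simp: chains_to_Suc)
  with chains_to_le_quasi_rank[OF assms(1) y(1,3)] quasi_rank_less[OF assms(1,2) y(1,2)] assms(3)
  show ?thesis by (intro bexI[of _ y]) auto
qed

lemma quasi_rank_level_below:
  assumes "finite_quasi_rank P" "x \<in> P" "k \<le> quasi_rank P x"
  shows "\<exists>y\<in>P. y \<le> x \<and> quasi_rank P y = k"
  using assms(3)
proof (induction k rule: inc_induct)
  case base
  then show ?case using assms by auto
next
  case (step k)
  then show ?case using quasi_rank_pred[OF assms(1)] by (meson less_le_not_le order_trans)
qed

lemma rank_elem:
  assumes "finite_quasi_rank P" "P \<noteq> {}" "enat n \<le> poset_quasi_rank P"
  shows "rank_elem P n \<in> P" "quasi_rank P (rank_elem P n) = n"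
proof -
  obtain x where "x \<in> P" "n \<le> quasi_rank P x"
  \<comment> \<open>The supremum may be infinite. For \<open>n = Suc m\<close>, the strict bound
    \<open>m < poset_quasi_rank P\<close> yields an element of quasi-rank above \<open>m\<close>;
    for \<open>n = 0\<close> any element will do.\<close>
  proof (cases n)
    case 0
    then show ?thesis using assms that by auto
  next
    case (Suc m)
    then have "enat m < poset_quasi_rank P"
      using assms(3) by (metis enat_ord_simps(2) lessI less_le_trans)
    then show ?thesis
      using that Suc by (auto simp: poset_quasi_rank_def less_SUP_iff)
  qed
  then have "\<exists>y. y \<in> P \<and> quasi_rank P y = n"
    using quasi_rank_level_below[OF assms(1)] by blast
  then have "rank_elem P n \<in> P \<and> quasi_rank P (rank_elem P n) = n"
    unfolding rank_elem_def by (rule someI_ex)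
  then show "rank_elem P n \<in> P" "quasi_rank P (rank_elem P n) = n" by auto
qed

section \<open>Counting chains that start in quasi-rank 0\<close>

definition rooted_chains :: "'a::order set \<Rightarrow> 'a \<Rightarrow> nat \<Rightarrow> 'a list set" where
  "rooted_chains P x j = {xs \<in> chains_to P x j. quasi_rank P (hd xs) = 0}"

lemma rooted_chains_0: "x \<in> P \<Longrightarrow> rooted_chains P x 0 = (if quasi_rank P x = 0 then {[x]} else {})"
  by (auto simp: rooted_chains_def chains_to_0)

lemma rooted_chains_Suc:
  "x \<in> P \<Longrightarrow> rooted_chains P x (Suc j) =
     (\<Union>y\<in>{y\<in>P. y < x}. (\<lambda>ys. ys @ [x]) ` rooted_chains P y j)"
proof -
  assume "x \<in> P"
  have "hd (ys @ [x]) = hd ys" if "ys \<in> chains_to P y j" for y ys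
    using that by (auto simp: chains_to_def hd_append)
  then show ?thesis
    using \<open>x \<in> P\<close> unfolding rooted_chains_def chains_to_Suc by fastforce
qed

context
  fixes P :: "'a::order set"
  assumes uniform: "quasi_rank_uniform P"
begin

lemma uniform_finite_quasi_rank: "finite_quasi_rank P"
  using uniform by (simp add: quasi_rank_uniform_def)

lemma finite_down_level: "x \<in> P \<Longrightarrow> k \<le> quasi_rank P x \<Longrightarrow> finite (down_level P x k)"
  using uniform unfolding quasi_rank_uniform_def by blast

lemma card_down_level:
  assumes "x \<in> P" "k \<le> quasi_rank P x" "enat (quasi_rank P x) \<le> poset_quasi_rank P"
  shows "card (down_level P x k) = rank_matrix P (quasi_rank P x) k"
proof -
  have "P \<noteq> {}" using assms(1) by auto
  note e = rank_elem[OF uniform_finite_quasi_rank this assms(3)]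
  show ?thesis
    unfolding rank_matrix_def using uniform e assms(1,2) unfolding quasi_rank_uniform_def by metis
qed

lemma quasi_rank_le_poset_quasi_rank: "x \<in> P \<Longrightarrow> enat (quasi_rank P x) \<le> poset_quasi_rank P"
  unfolding poset_quasi_rank_def by (rule SUP_upper)

lemma strict_down_set:
  assumes "x \<in> P"
  shows "{y\<in>P. y < x} = (\<Union>k<quasi_rank P x. down_level P x k)"
proof (intro Set.set_eqI iffI)
  fix y assume "y \<in> {y\<in>P. y < x}"
  then show "y \<in> (\<Union>k<quasi_rank P x. down_level P x k)"
    using quasi_rank_less[OF uniform_finite_quasi_rank assms, of y] by (auto simp: down_level_def)
next
  fix y assume "y \<in> (\<Union>k<quasi_rank P x. down_level P x k)"
  then show "y \<in> {y\<in>P. y < x}" by (auto simp: down_level_def less_le)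
qed

lemma finite_strict_down_set: "x \<in> P \<Longrightarrow> finite {y\<in>P. y < x}"
  unfolding strict_down_set by (auto intro: finite_down_level)

lemma finite_rooted_chains: "x \<in> P \<Longrightarrow> finite (rooted_chains P x j)"
proof (induction j arbitrary: x)
  case (Suc j)
  then show ?case
    unfolding rooted_chains_Suc[OF Suc.prems] by (intro finite_UN_I finite_strict_down_set) auto
qed (simp add: rooted_chains_0)

lemma card_rooted_chains_Suc:
  assumes "x \<in> P"
  shows "card (rooted_chains P x (Suc j)) = (\<Sum>y\<in>{y\<in>P. y < x}. card (rooted_chains P y j))"
proof -
  have "card (rooted_chains P x (Suc j)) =
      (\<Sum>y\<in>{y\<in>P. y < x}. card ((\<lambda>ys. ys @ [x]) ` rooted_chains P y j))"
    unfolding rooted_chains_Suc[OF assms]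
    by (rule card_UN_disjoint)
      (auto simp: finite_rooted_chains finite_strict_down_set assms, auto simp: rooted_chains_def chains_to_def)
  also have "\<dots> = (\<Sum>y\<in>{y\<in>P. y < x}. card (rooted_chains P y j))"
    by (intro sum.cong refl card_image) (auto simp: inj_on_def)
  finally show ?thesis .
qed

definition chain_count :: "nat \<Rightarrow> nat \<Rightarrow> nat" where
  "chain_count n j = card (rooted_chains P (rank_elem P n) j)"

text \<open>The elements strictly below \<open>x\<close> are grouped by quasi-rank. Independence of
  the chosen element is assumed for length \<open>j\<close> only, so that the recursion can serve
  inside the induction that proves it.\<close>

lemma card_rooted_chains_rec:
  assumes "x \<in> P" and "\<And>y. y \<in> P \<Longrightarrow> card (rooted_chains P y j) = chain_count (quasi_rank P y) j"
  shows "card (rooted_chains P x (Suc j)) =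
    (\<Sum>k<quasi_rank P x. rank_matrix P (quasi_rank P x) k * chain_count k j)"
proof -
  have "card (rooted_chains P x (Suc j)) = (\<Sum>y\<in>{y\<in>P. y < x}. chain_count (quasi_rank P y) j)"
    unfolding card_rooted_chains_Suc[OF assms(1)] using assms(2) by (intro sum.cong) auto
  also have "\<dots> = (\<Sum>k<quasi_rank P x. \<Sum>y\<in>down_level P x k. chain_count (quasi_rank P y) j)"
    unfolding strict_down_set[OF assms(1)]
    by (rule sum.UNION_disjoint) (use assms finite_down_level in \<open>auto simp: down_level_def\<close>)
  also have "\<dots> = (\<Sum>k<quasi_rank P x. \<Sum>y\<in>down_level P x k. chain_count k j)"
    by (intro sum.cong) (auto simp: down_level_def)
  also have "\<dots> = (\<Sum>k<quasi_rank P x. rank_matrix P (quasi_rank P x) k * chain_count k j)"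
    using assms(1) by (intro sum.cong) (auto simp: card_down_level quasi_rank_le_poset_quasi_rank)
  finally show ?thesis .
qed

text \<open>By induction on \<open>j\<close>: the recursion has the same right-hand side for
  \<open>x\<close> and for the chosen element of its quasi-rank.\<close>

lemma card_rooted_chains:
  "x \<in> P \<Longrightarrow> card (rooted_chains P x j) = chain_count (quasi_rank P x) j"
proof (induction j arbitrary: x)
  case 0
  then have e: "rank_elem P (quasi_rank P x) \<in> P" "quasi_rank P (rank_elem P (quasi_rank P x)) = quasi_rank P x"
    using rank_elem[OF uniform_finite_quasi_rank _ quasi_rank_le_poset_quasi_rank] by auto
  then show ?case using 0 by (simp add: chain_count_def rooted_chains_0)
next
  case (Suc j)
  then have e: "rank_elem P (quasi_rank P x) \<in> P" "quasi_rank P (rank_elem P (quasi_rank P x)) = quasi_rank P x"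
    using rank_elem[OF uniform_finite_quasi_rank _ quasi_rank_le_poset_quasi_rank] by auto
  show ?case
    using card_rooted_chains_rec[OF Suc.prems Suc.IH] card_rooted_chains_rec[OF e(1) Suc.IH] e
    by (simp add: chain_count_def)
qed

text \<open>The range \<open>1..n\<close> of the defining sum loses nothing: no chain has
  \<open>j > n\<close>, and for \<open>n > 0\<close> the one-element chain does not start in
  quasi-rank 0.\<close>

lemma coeff_chain_poly:
  assumes "P \<noteq> {}" "enat n \<le> poset_quasi_rank P"
  shows "coeff (chain_poly P n) j = real (chain_count n j)"
proof -
  note e = rank_elem[OF uniform_finite_quasi_rank assms]
  have zero: "chain_count n j = 0" if "j > n"
  proof -
    have "chains_to P (rank_elem P n) j = {}"
      using chains_to_le_quasi_rank[OF uniform_finite_quasi_rank e(1), of j] that e(2) by auto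
    then show ?thesis by (simp add: chain_count_def rooted_chains_def)
  qed
  show ?thesis
  proof (cases "n = 0")
    case True
    then show ?thesis using e zero
      by (cases "j = 0") (auto simp: chain_poly_def chain_count_def rooted_chains_0)
  next
    case False
    have "coeff (chain_poly P n) j = (\<Sum>i=1..n. if i = j then real (chain_count n i) else 0)"
      using False unfolding chain_poly_def chain_count_def rooted_chains_def by (simp add: coeff_sum)
    also have "\<dots> = (if j \<in> {1..n} then real (chain_count n j) else 0)" by (simp add: sum.delta)
    also have "\<dots> = real (chain_count n j)"
      using False e zero by (auto simp: chain_count_def rooted_chains_0 not_le Suc_le_eq)
    finally show ?thesis .
  qed
qed

lemma chain_poly_Suc:
  assumes "enat (Suc n) \<le> poset_quasi_rank P"
  shows "chain_poly P (Suc n) =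
    pCons 0 (\<Sum>k\<le>n. Polynomial.smult (real (rank_matrix P (Suc n) k)) (chain_poly P k))"
proof (rule poly_eqI)
  fix j
  have "P \<noteq> {}" using assms by (auto simp: poset_quasi_rank_def bot_enat_def enat_0_iff)
  have below: "enat k \<le> poset_quasi_rank P" if "k \<le> Suc n" for k
    using assms that by (meson enat_ord_simps(1) order_trans)
  note e = rank_elem[OF uniform_finite_quasi_rank \<open>P \<noteq> {}\<close> assms]
  note coeff = coeff_chain_poly[OF \<open>P \<noteq> {}\<close> below]
  show "coeff (chain_poly P (Suc n)) j =
      coeff (pCons 0 (\<Sum>k\<le>n. Polynomial.smult (real (rank_matrix P (Suc n) k)) (chain_poly P k))) j"
  proof (cases j)
    case 0
    then show ?thesis using e by (simp add: coeff chain_count_def rooted_chains_0)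
  next
    case (Suc i)
    have "chain_count (Suc n) (Suc i) = (\<Sum>k<Suc n. rank_matrix P (Suc n) k * chain_count k i)"
      using card_rooted_chains_rec[OF e(1) card_rooted_chains] e by (simp add: chain_count_def)
    then show ?thesis
      using Suc by (simp add: coeff coeff_sum lessThan_Suc_atMost del: sum.atMost_Suc)
  qed
qed

text \<open>Strict monotonicity of the quasi-rank gives the triangular shape and the unit diagonal;
  elements of every smaller quasi-rank below the chosen one give positivity. The elimination needs
  the latter just below the diagonal.\<close>

lemma rank_matrix_properties:
  assumes "P \<noteq> {}" "enat n \<le> poset_quasi_rank P"
  shows "rank_matrix P n n = 1" "n < k \<Longrightarrow> rank_matrix P n k = 0" "k \<le> n \<Longrightarrow> rank_matrix P n k > 0"
proof -
  note e = rank_elem[OF uniform_finite_quasi_rank assms]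
  have less: "quasi_rank P z < n" if "z \<in> P" "z < rank_elem P n" for z
    using quasi_rank_less[OF uniform_finite_quasi_rank e(1) that] e(2) by simp
  have "down_level P (rank_elem P n) n = {rank_elem P n}"
    using e less by (force simp: down_level_def le_less)
  then show "rank_matrix P n n = 1" by (simp add: rank_matrix_def)
  show "rank_matrix P n k = 0" if "n < k"
  proof -
    have "down_level P (rank_elem P n) k = {}"
      using e less that by (force simp: down_level_def le_less)
    then show ?thesis by (simp add: rank_matrix_def)
  qed
  show "rank_matrix P n k > 0" if "k \<le> n"
    using quasi_rank_level_below[OF uniform_finite_quasi_rank e(1), of k] e that
      finite_down_level[OF e(1), of k]
    by (auto simp: rank_matrix_def card_gt_0_iff down_level_def)
qed

end

section \<open>Zeros of the chain polynomials\<close>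

lemma cpoly_sum: "cpoly (\<Sum>k\<in>K. f k) = (\<Sum>k\<in>K. cpoly (f k))"
  by (rule poly_eqI) (simp add: coeff_map_poly coeff_sum)

lemma cpoly_smult: "cpoly (Polynomial.smult c f) = Polynomial.smult (of_real c) (cpoly f)"
  by (rule poly_eqI) (simp add: coeff_map_poly)

lemma poly_cpoly_cnj: "poly (cpoly f) (cnj z) = cnj (poly (cpoly f) z)"
  by (induction f) (simp_all add: map_poly_pCons)

section \<open>Polynomial sequences generated by a unit lower triangular matrix\<close>

context
  fixes A :: "nat \<Rightarrow> nat \<Rightarrow> real" and p :: "nat \<Rightarrow> real poly" and N :: nat
  assumes minors: "contiguous_minors_nonneg N 0 A"
    and diag: "\<And>n. n \<le> N \<Longrightarrow> A n n = 1" and tri: "\<And>n j. n \<le> N \<Longrightarrow> n < j \<Longrightarrow> A n j = 0"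
    and sub: "\<And>n. n < N \<Longrightarrow> A (Suc n) n > 0"
    and p_0: "p 0 = 1"
    and p_Suc: "\<And>n. n < N \<Longrightarrow> p (Suc n) = pCons 0 (\<Sum>k\<le>n. Polynomial.smult (A (Suc n) k) (p k))"
begin

text \<open>In the recurrence only the last summand reaches the top degree, and its coefficient is a
  positive subdiagonal entry.\<close>

lemma chain_sequence_degree:
  assumes "n \<le> N"
  shows "degree (p n) = n" "lead_coeff (p n) > 0"
proof -
  have "degree (p n) = n \<and> coeff (p n) n > 0"
    using assms
  proof (induction n rule: less_induct)
    case (less n)
    show ?case
    proof (cases n)
      case 0
      then show ?thesis by (simp add: p_0)
    next
      case (Suc m)
      have small: "coeff (p k) j = 0" if "k < n" "k < j" for k j
        using less.IH[of k] less.prems that by (simp add: coeff_eq_0)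
      have "coeff (p n) (Suc m) = (\<Sum>k\<le>m. A (Suc m) k * coeff (p k) m)"
        using p_Suc[of m] less.prems Suc by (simp add: coeff_sum)
      also have "\<dots> = (\<Sum>k\<in>{m}. A (Suc m) k * coeff (p k) m)"
        using small Suc by (intro sum.mono_neutral_right) auto
      finally have top: "coeff (p n) n > 0"
        using sub[of m] less.IH[of m] less.prems Suc by simp
      have "coeff (p n) j = 0" if "j > n" for j
        using p_Suc[of m] less.prems Suc that small by (cases j) (auto simp: coeff_sum)
      then have "degree (p n) \<le> n" by (intro degree_le) auto
      then have "degree (p n) = n"
        using top le_degree[of "p n" n] by auto
      then show ?thesis using top by simp
    qed
  qed
  then show "degree (p n) = n" "lead_coeff (p n) > 0" by auto
qed

lemma chain_sequence_upper_half_plane: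
  assumes z: "Im z > 0" and n: "n \<le> N"
  shows "poly (cpoly (p n)) z \<noteq> 0"
    and "n < N \<Longrightarrow> Im (poly (cpoly (p (Suc n))) z * cnj (poly (cpoly (p n)) z)) \<ge> 0"
proof -
  define P where "P n = poly (cpoly (p n)) z" for n
  have P_Suc: "P (Suc n) = z * (\<Sum>k\<le>n. of_real (A (Suc n) k) * P k)" if "n < N" for n
    unfolding P_def p_Suc[OF that] by (simp add: map_poly_pCons cpoly_sum cpoly_smult poly_sum)
  obtain l q where
    l: "\<And>n k. n < N \<Longrightarrow> k \<le> n \<Longrightarrow> l n k \<ge> 0" "\<And>n. n < N \<Longrightarrow> \<exists>k\<le>n. l n k > (0::real)"
    and diag_q: "\<And>n. n \<le> N \<Longrightarrow> q n n = P n"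
    and q: "\<And>n k. n < N \<Longrightarrow> k \<le> Suc n \<Longrightarrow>
       q (Suc n) k = z * (\<Sum>j\<le>n. of_real (l n j) * q n j) + (\<Sum>j=k..n. of_real (l n j) * q n j)"
    using neville_resolution[OF minors diag tri sub P_Suc] by blast
  have "q 0 0 = 1" using diag_q[of 0] by (simp add: P_def p_0)
  then have sector: "sector_ordered z n (q n) \<and> (\<exists>c. \<forall>k\<le>n. Im (q n k * c) > 0)"
    by (rule resolution_upper_half_plane[where N = N and l = l, OF z])
      (fact l(1), fact l(2), fact q, fact n)
  then obtain c where "Im (q n n * c) > 0" by auto
  then show "poly (cpoly (p n)) z \<noteq> 0" using diag_q[OF n] by (auto simp: P_def)
  show "Im (poly (cpoly (p (Suc n))) z * cnj (poly (cpoly (p n)) z)) \<ge> 0" if "n < N"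
  proof -
    \<comment> \<open>At \<open>k = Suc n\<close> the tail sum is empty, so \<open>P (Suc n)\<close>
      is \<open>z\<close> times a nonnegative combination of the \<open>q n j\<close>. The second
      condition of \<open>sector_ordered\<close> then compares each \<open>z * q n j\<close> with
      \<open>q n n = P n\<close>.\<close>
    have "P (Suc n) = z * (\<Sum>j\<le>n. of_real (l n j) * q n j)"
      using q[OF that, of "Suc n"] diag_q[of "Suc n"] that by simp
    moreover have "Im (z * (\<Sum>j\<le>n. of_real (l n j) * q n j) * cnj (sum (q n) {n})) \<ge> 0"
    proof (rule Im_sum_cnj_sum_nonneg)
      fix a b assume "a \<in> {..n}" "b \<in> {n}"
      have "Im (z * (of_real (l n a) * q n a) * cnj (q n b)) = l n a * Im (z * q n a * cnj (q n b))"
        by (simp add: algebra_simps)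
      then show "Im (z * (of_real (l n a) * q n a) * cnj (q n b)) \<ge> 0"
        using l(1)[OF that] sector_orderedD(2)[OF conjunct1[OF sector]] \<open>a \<in> {..n}\<close> \<open>b \<in> {n}\<close>
        by (simp del: times_complex.sel)
    qed
    ultimately show ?thesis using diag_q[OF n] by (simp add: P_def)
  qed
qed

lemma chain_sequence_real:
  assumes x: "x < -1 \<or> x > 0" and n: "n \<le> N"
  shows "poly (p n) x \<noteq> 0"
proof -
  define P where "P n = poly (p n) x" for n
  have P_Suc: "P (Suc n) = x * (\<Sum>k\<le>n. of_real (A (Suc n) k) * P k)" if "n < N" for n
    unfolding P_def p_Suc[OF that] by (simp add: poly_sum)
  obtain l q where
    l: "\<And>n k. n < N \<Longrightarrow> k \<le> n \<Longrightarrow> l n k \<ge> 0" "\<And>n. n < N \<Longrightarrow> \<exists>k\<le>n. l n k > (0::real)"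
    and diag_q: "\<And>n. n \<le> N \<Longrightarrow> q n n = P n"
    and q: "\<And>n k. n < N \<Longrightarrow> k \<le> Suc n \<Longrightarrow>
       q (Suc n) k = x * (\<Sum>j\<le>n. of_real (l n j) * q n j) + (\<Sum>j=k..n. of_real (l n j) * q n j)"
    using neville_resolution[OF minors diag tri sub P_Suc] by blast
  have "q 0 0 = 1" using diag_q[of 0] by (simp add: P_def p_0)
  then have "\<exists>c. \<forall>k\<le>n. q n k * c > 0"
    by (rule resolution_real[where N = N and l = l, OF x])
      (fact l(1), fact l(2), fact q[unfolded of_real_eq_id id_apply], fact n)
  then obtain c where "q n n * c > 0" by auto
  then show ?thesis using diag_q[OF n] by (auto simp: P_def)
qed

lemma chain_sequence_zeros:
  assumes n: "n \<le> N" and zero: "poly (cpoly (p n)) z = 0"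
  shows "z \<in> complex_of_real ` {-1..0}"
proof -
  have "\<not> Im z > 0" using chain_sequence_upper_half_plane(1)[OF _ n] zero by blast
  \<comment> \<open>The coefficients are real, so the conjugate of a zero is a zero.\<close>
  moreover have "\<not> Im z < 0"
    using chain_sequence_upper_half_plane(1)[of "cnj z", OF _ n] zero by (auto simp: poly_cpoly_cnj)
  ultimately have "z = of_real (Re z)" by (simp add: complex_eq_iff)
  moreover from this have "poly (p n) (Re z) = 0"
    using zero poly_cpoly_of_real[of "p n" "Re z"] by simp
  then have "Re z \<in> {-1..0}" using chain_sequence_real[OF _ n, of "Re z"] by force
  ultimately show ?thesis by blast
qed

lemma chain_sequence_interlaces:
  assumes "n < N"
  shows "interlaces (p n) (p (Suc n))"
proof (rule interlacesI)
  show "real_rooted (p n)" "real_rooted (p (Suc n))"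
    unfolding real_rooted_def using chain_sequence_zeros[of n] chain_sequence_zeros[of "Suc n"] assms by force+
qed (use assms chain_sequence_degree chain_sequence_upper_half_plane in auto)

end

lemma contiguous_minors_rank_matrix:
  assumes "TN_poset P" "enat N \<le> poset_quasi_rank P"
  shows "contiguous_minors_nonneg N 0 (\<lambda>n k. real (rank_matrix P n k))"
  unfolding contiguous_minors_nonneg_def
proof (intro allI impI, elim conjE)
  fix m i c
  assume "i + m \<le> Suc N" and c: "strict_mono_on {..<m} c" "\<forall>a<m. 0 \<le> c a \<and> c a \<le> N"
  have "enat (i + a) \<le> poset_quasi_rank P" "enat (c a) \<le> poset_quasi_rank P" if "a < m" for a
    using assms(2) that c \<open>i + m \<le> Suc N\<close> by (auto intro: order_trans[OF _ assms(2)])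
  moreover have "strict_mono_on {..<m} (\<lambda>a. i + a)" by (auto simp: strict_mono_on_def)
  ultimately show "Determinant.det (Matrix.mat m m (\<lambda>(a, b). real (rank_matrix P (i + a) (c b)))) \<ge> 0"
    using assms(1) c(1) unfolding TN_poset_def totally_nonnegative_def by blast
qed

theorem theorem5p5:
  fixes P :: "'a::order set"
  assumes "TN_poset P"
  shows "\<forall>n::nat. enat n \<le> poset_quasi_rank P \<longrightarrow>
           (\<forall>z::complex. poly (map_poly complex_of_real (chain_poly P n)) z = 0 \<longrightarrow>
              z \<in> complex_of_real ` {-1..0}) \<and>
           (enat (n + 1) \<le> poset_quasi_rank P \<longrightarrow>
              interlaces (chain_poly P n) (chain_poly P (n + 1)))"
proof (cases "P = {}")
  case True
  \<comment> \<open>The supremum over the empty set is 0, so only \<open>n = 0\<close> occurs, with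
    the constant polynomial 1.\<close>
  then show ?thesis
    by (auto simp: poset_quasi_rank_def bot_enat_def enat_0_iff chain_poly_def)
next
  case False
  have uniform: "quasi_rank_uniform P" using assms by (simp add: TN_poset_def)
  \<comment> \<open>The matrix may be infinite, so the argument runs on its finite section up to
    \<open>N\<close>. It is applied with \<open>N = n\<close> for the zeros and with
    \<open>N = n + 1\<close> for the interlacing.\<close>
  have main: "(\<forall>n\<le>N. \<forall>z. poly (cpoly (chain_poly P n)) z = 0 \<longrightarrow> z \<in> complex_of_real ` {-1..0}) \<and>
      (\<forall>n<N. interlaces (chain_poly P n) (chain_poly P (Suc n)))"
    if N: "enat N \<le> poset_quasi_rank P" for N
  proof -
    have below: "enat k \<le> poset_quasi_rank P" if "k \<le> N" for k
      using that N by (meson enat_ord_simps(1) order_trans)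
    note R = rank_matrix_properties[OF uniform False below]
    have "chain_poly P 0 = 1" by (simp add: chain_poly_def)
    note hyps = contiguous_minors_rank_matrix[OF assms N] R this chain_poly_Suc[OF uniform below]
    show ?thesis
    proof (intro conjI allI impI)
      fix n z assume "n \<le> N" "poly (cpoly (chain_poly P n)) z = 0"
      then show "z \<in> complex_of_real ` {-1..0}"
        by (intro chain_sequence_zeros[of N "\<lambda>n k. real (rank_matrix P n k)" "chain_poly P" n z])
          (use hyps in \<open>auto simp: Suc_le_eq\<close>)
    next
      fix n assume "n < N"
      then show "interlaces (chain_poly P n) (chain_poly P (Suc n))"
        by (intro chain_sequence_interlaces[of N "\<lambda>n k. real (rank_matrix P n k)" "chain_poly P" n])
          (use hyps in \<open>auto simp: Suc_le_eq\<close>)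
    qed
  qed
  show ?thesis
  proof (intro allI impI conjI)
    fix n z assume "enat n \<le> poset_quasi_rank P" "poly (cpoly (chain_poly P n)) z = 0"
    then show "z \<in> complex_of_real ` {-1..0}" using main[of n] by blast
  next
    fix n assume "enat (n + 1) \<le> poset_quasi_rank P"
    then show "interlaces (chain_poly P n) (chain_poly P (n + 1))" using main[of "n + 1"] by simp
  qed
qed

end
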